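(* Let $\mathcal{T}_h$ be a shape-regular simplicial triangulation of a contractible polyhedral domain $\Omega\subset\mathbb{R}^3$, let $\mathcal{T}_h^{\rm WF}$ be its Worsey--Farin refinement, and let $\mathcal{S}_h$ be the set of face split points of $\mathcal{T}_h^{\rm WF}$. For $z\in\mathcal{S}_h$ and $j\in\{1,\dots,n_z\}$, let $\varphi_z^{(j)}$ be the piecewise constant function on $\mathcal{T}_h^{\rm WF}$ equal to $1$ on $K_z^{(j)}$ and $0$ on every other tetrahedron. For an interior face split point $z$, define $$\psi_z^{(3)}=\varphi_z^{(3)}+\varphi_z^{(1)}+\varphi_z^{(2)},\qquad \psi_z^{(4)}=\varphi_z^{(4)}+\varphi_z^{(1)},$$ $$\psi_z^{(5)}=\varphi_z^{(5)}+\varphi_z^{(2)},\qquad \psi_z^{(6)}=\varphi_z^{(6)}-\varphi_z^{(1)}-\varphi_z^{(2)}.$$ For a boundary face split point $z$, define $$\psi_z^{(3)}=\varphi_z^{(3)}+\varphi_z^{(1)}+\varphi_z^{(2)}.$$ Then the collection $\{\psi_z^{(j)}\}$ (with $j\in\{3,4,5,6\}$ for interior $z\in\mathcal{S}_h$ and $j=3$ for boundary $z\in\mathcal{S}_h$) is a basis of $$\hat{Y}_h^{\rm WF}=\{q\in\mathcal{P}_0(\mathcal{T}_h^{\rm WF}):\ \theta_e(q)=0\ \ \forall e\in\mathcal{E}_h^{\mathcal{S}}\}.$$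
   Context: Triangulations are conforming. Worsey--Farin refinement $\mathcal{T}_h^{\rm WF}$ of $\mathcal{T}_h$: connect the incenter of each tetrahedron $T\in\mathcal{T}_h$ to its vertices; connect the incenters of each pair of neighboring (face-sharing) tetrahedra by a segment, whose intersection with the common face is a face split point; if $T$ has a boundary face, connect the incenter of $T$ to the barycenter of that face, which is then the face split point; finally, connect each face split point to the vertices of its face. Each tetrahedron of $\mathcal{T}_h$ is thereby split into twelve sub-tetrahedra. $\mathcal{S}_h^I$ and $\mathcal{S}_h^B$ are the sets of interior and boundary face split points, and $\mathcal{S}_h=\mathcal{S}_h^I\cup\mathcal{S}_h^B$. For $z\in\mathcal{S}_h$, $\mathcal{T}_z=\{K_z^{(1)},\dots,K_z^{(n_z)}\}$ is the set of tetrahedra of $\mathcal{T}_h^{\rm WF}$ having $z$ as a vertex, with $n_z=6$ if $z$ is interior and $n_z=3$ if $z$ is a boundary point. For interior $z$ the labeling is such that $K_z^{(1)},K_z^{(2)},K_z^{(3)}\subset T^{(1)}$ and $K_z^{(4)},K_z^{(5)},K_z^{(6)}\subset T^{(2)}$ for some $T^{(1)},T^{(2)}\in\mathcal{T}_h$, and $K_z^{(j)}$ and $K_z^{(j+3)}$ share a common face for $j\in\{1,2,3\}$; for boundary $z$ the labeling is arbitrary. Each tetrahedron of $\mathcal{T}_h^{\rm WF}$ equals $K_z^{(j)}$ for exactly one pair $(z,j)$. An edge in a 3D simplicial triangulation is singular if the faces meeting at the edge fall on exactly two planes. $\mathcal{E}_h^{\mathcal{S}}$ is the set of singular edges of $\mathcal{T}_h^{\rm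 WF}$ (for each face of $\mathcal{T}_h$, the three segments joining its split point to its vertices). For $e\in\mathcal{E}_h^{\mathcal{S}}$, let $K_e^{(1)},\dots,K_e^{(n_e)}$ be the tetrahedra of $\mathcal{T}_h^{\rm WF}$ having $e$ as an edge, with $n_e=4$ if $e$ is an interior edge and $n_e=2$ if $e$ is a boundary edge, labeled so that $K_e^{(j)}$ and $K_e^{(j+1)}$ share a common face. $\mathcal{P}_0(\mathcal{T}_h^{\rm WF})$ is the space of piecewise constant functions on $\mathcal{T}_h^{\rm WF}$. For $q\in\mathcal{P}_0(\mathcal{T}_h^{\rm WF})$, with $q_e^{(j)}=q|_{K_e^{(j)}}$, $\theta_e(q)=q_e^{(1)}|_e-q_e^{(2)}|_e+q_e^{(3)}|_e-q_e^{(4)}|_e$ if $e$ is interior, and $\theta_e(q)=q_e^{(1)}|_e-q_e^{(2)}|_e$ if $e$ is on the boundary. *)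

theory Defs
  imports "HOL-Analysis.Analysis" "HOL-Library.Function_Algebras"
begin

text \<open>Pointwise real vector space structure on functions, so that \<open>span\<close> and \<open>independent\<close>
  are available for spaces of (piecewise constant) functions.\<close>

instantiation "fun" :: (type, real_vector) real_vector
begin

definition scaleR_fun_def: "scaleR r f = (\<lambda>x. scaleR r (f x))"

instance
  by standard (auto simp: scaleR_fun_def fun_eq_iff scaleR_add_left scaleR_add_right)

end

type_synonym point = "real^3"

section \<open>Domains, meshes, shape regularity\<close>

text \<open>The condition \<open>interior (closure \<Omega>) = \<Omega>\<close> says that the domain lies on one side of its
  boundary (no slits); it holds in particular for Lipschitz domains.\<close>

definition polyhedral_domain :: "point set \<Rightarrow> bool" where
  "polyhedral_domain \<Omega> \<longleftrightarrow>
     open \<Omega> \<and> connected \<Omega> \<and> \<Omega> \<noteq> {} \<and> interior (closure \<Omega>) = \<Omega> \<and>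
     (\<exists>P. finite P \<and> (\<forall>Q\<in>P. polytope Q) \<and> closure \<Omega> = \<Union>P)"

text \<open>Conformity is part of the library predicate \<open>triangulation\<close>.\<close>

definition tet_mesh :: "point set \<Rightarrow> point set set \<Rightarrow> bool" where
  "tet_mesh \<Omega> \<T> \<longleftrightarrow> triangulation \<T> \<and> (\<forall>T\<in>\<T>. 3 simplex T) \<and> \<Union>\<T> = closure \<Omega>"

definition incenter :: "point set \<Rightarrow> point" where
  "incenter T = (THE c. c \<in> interior T \<and>
     (\<exists>r. \<forall>F. F facet_of T \<longrightarrow> infdist c (affine hull F) = r))"

definition inradius :: "point set \<Rightarrow> real" where
  "inradius T = infdist (incenter T) (frontier T)"

definition shape_regular :: "real \<Rightarrow> point set set \<Rightarrow> bool" where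
  "shape_regular \<gamma> \<T> \<longleftrightarrow> (\<forall>T\<in>\<T>. diameter T \<le> \<gamma> * (2 * inradius T))"

section \<open>Worsey--Farin refinement\<close>

definition mesh_faces :: "point set set \<Rightarrow> point set set" where
  "mesh_faces M = {F. \<exists>T\<in>M. F facet_of T}"

definition mesh_edges :: "point set set \<Rightarrow> point set set" where
  "mesh_edges M = {e. \<exists>T\<in>M. e edge_of T}"

definition face_barycenter :: "point set \<Rightarrow> point" where
  "face_barycenter F = (1/3) *\<^sub>R (\<Sum>v | v extreme_point_of F. v)"

definition face_split_point :: "point set \<Rightarrow> point set set \<Rightarrow> point set \<Rightarrow> point" where
  "face_split_point \<Omega> \<T> F =
     (if F \<subseteq> frontier \<Omega> then face_barycenter F
      else (THE z. \<exists>T\<^sub>1\<in>\<T>. \<exists>T\<^sub>2\<in>\<T>. T\<^sub>1 \<noteq> T\<^sub>2 \<and> F facet_of T\<^sub>1 \<and> F facet_of T\<^sub>2 \<and>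
              z \<in> closed_segment (incenter T\<^sub>1) (incenter T\<^sub>2) \<inter> F))"

definition WF :: "point set \<Rightarrow> point set set \<Rightarrow> point set set" where
  "WF \<Omega> \<T> = {convex hull ({incenter T, face_split_point \<Omega> \<T> F} \<union> e) |T F e.
               T \<in> \<T> \<and> F facet_of T \<and> e edge_of F}"

definition interior_split_points :: "point set \<Rightarrow> point set set \<Rightarrow> point set" where
  "interior_split_points \<Omega> \<T> = face_split_point \<Omega> \<T> ` {F \<in> mesh_faces \<T>. \<not> F \<subseteq> frontier \<Omega>}"

definition boundary_split_points :: "point set \<Rightarrow> point set set \<Rightarrow> point set" where
  "boundary_split_points \<Omega> \<T> = face_split_point \<Omega> \<T> ` {F \<in> mesh_faces \<T>. F \<subseteq> frontier \<Omega>}"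

definition share_face :: "point set \<Rightarrow> point set \<Rightarrow> bool" where
  "share_face K K' \<longleftrightarrow> K \<noteq> K' \<and> (\<exists>G. G facet_of K \<and> G facet_of K')"

text \<open>An admissible labeling \<open>K z j\<close>, \<open>j = 1..n\<^sub>z\<close>, of the refined tetrahedra around every face
  split point \<open>z\<close>.\<close>

definition split_point_labeling ::
    "point set \<Rightarrow> point set set \<Rightarrow> (point \<Rightarrow> nat \<Rightarrow> point set) \<Rightarrow> bool" where
  "split_point_labeling \<Omega> \<T> K \<longleftrightarrow>
     (\<forall>z \<in> interior_split_points \<Omega> \<T>.
        bij_betw (K z) {1..6} {S \<in> WF \<Omega> \<T>. z extreme_point_of S} \<and>
        (\<exists>T\<^sub>1\<in>\<T>. \<exists>T\<^sub>2\<in>\<T>. (\<forall>j\<in>{1,2,3}. K z j \<subseteq> T\<^sub>1) \<and> (\<forall>j\<in>{4,5,6}. K z j \<subseteq> T\<^sub>2)) \<and>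
        (\<forall>j\<in>{1,2,3}. share_face (K z j) (K z (j + 3)))) \<and>
     (\<forall>z \<in> boundary_split_points \<Omega> \<T>.
        bij_betw (K z) {1..3} {S \<in> WF \<Omega> \<T>. z extreme_point_of S})"

section \<open>Singular edges\<close>

definition singular_edges :: "point set set \<Rightarrow> point set set" where
  "singular_edges M =
     {e \<in> mesh_edges M. card {affine hull G |G. G \<in> mesh_faces M \<and> e edge_of G} = 2}"

text \<open>An admissible labeling \<open>L e j\<close>, \<open>j = 1..n\<^sub>e\<close>, of the refined tetrahedra around every
  singular edge \<open>e\<close>.\<close>

definition singular_edge_labeling ::
    "point set \<Rightarrow> point set set \<Rightarrow> (point set \<Rightarrow> nat \<Rightarrow> point set) \<Rightarrow> bool" where
  "singular_edge_labeling \<Omega> \<T> L \<longleftrightarrow>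
     (\<forall>e \<in> singular_edges (WF \<Omega> \<T>).
        let n = (if e \<subseteq> frontier \<Omega> then 2 else 4) in
        bij_betw (L e) {1..n} {S \<in> WF \<Omega> \<T>. e edge_of S} \<and>
        (\<forall>j\<in>{1..<n}. share_face (L e j) (L e (j + 1))))"

section \<open>Piecewise constant functions\<close>

text \<open>Piecewise constants are defined up to their values on the (null) skeleton of the mesh; the
  representative vanishing outside the open cells is used.\<close>

definition P0 :: "point set set \<Rightarrow> (point \<Rightarrow> real) set" where
  "P0 M = {q. (\<forall>S\<in>M. \<exists>c. \<forall>x\<in>interior S. q x = c) \<and> (\<forall>x. x \<notin> (\<Union>S\<in>M. interior S) \<longrightarrow> q x = 0)}"

text \<open>The constant value on a cell, which is also the trace of the restriction to that cell on
  any of its edges.\<close>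

definition cell_value :: "(point \<Rightarrow> real) \<Rightarrow> point set \<Rightarrow> real" where
  "cell_value q S = (THE c. \<forall>x\<in>interior S. q x = c)"

definition theta ::
    "point set \<Rightarrow> (point set \<Rightarrow> nat \<Rightarrow> point set) \<Rightarrow> point set \<Rightarrow> (point \<Rightarrow> real) \<Rightarrow> real" where
  "theta \<Omega> L e q =
     (if e \<subseteq> frontier \<Omega> then cell_value q (L e 1) - cell_value q (L e 2)
      else cell_value q (L e 1) - cell_value q (L e 2)
           + cell_value q (L e 3) - cell_value q (L e 4))"

definition Y_hat ::
    "point set \<Rightarrow> point set set \<Rightarrow> (point set \<Rightarrow> nat \<Rightarrow> point set) \<Rightarrow> (point \<Rightarrow> real) set" where
  "Y_hat \<Omega> \<T> L =
     {q \<in> P0 (WF \<Omega> \<T>). \<forall>e \<in> singular_edges (WF \<Omega> \<T>). theta \<Omega> L e q = 0}"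

definition phi :: "(point \<Rightarrow> nat \<Rightarrow> point set) \<Rightarrow> point \<Rightarrow> nat \<Rightarrow> point \<Rightarrow> real" where
  "phi K z j = indicator (interior (K z j))"

definition psi :: "(point \<Rightarrow> nat \<Rightarrow> point set) \<Rightarrow> point \<Rightarrow> nat \<Rightarrow> point \<Rightarrow> real" where
  "psi K z j =
     (if j = 3 then phi K z 3 + phi K z 1 + phi K z 2
      else if j = 4 then phi K z 4 + phi K z 1
      else if j = 5 then phi K z 5 + phi K z 2
      else if j = 6 then phi K z 6 - phi K z 1 - phi K z 2
      else 0)"

definition psi_index :: "point set \<Rightarrow> point set set \<Rightarrow> (point \<times> nat) set" where
  "psi_index \<Omega> \<T> =
     interior_split_points \<Omega> \<T> \<times> {3, 4, 5, 6} \<union> boundary_split_points \<Omega> \<T> \<times> {3}"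

text \<open>An indexed family is a basis of \<open>V\<close>: the members are pairwise distinct, linearly
  independent, and span \<open>V\<close>.\<close>

definition family_basis :: "('i \<Rightarrow> 'v::real_vector) \<Rightarrow> 'i set \<Rightarrow> 'v set \<Rightarrow> bool" where
  "family_basis b I V \<longleftrightarrow> inj_on b I \<and> independent (b ` I) \<and> span (b ` I) = V"

end

theory Submission
  imports Defs
begin

text \<open>
  The constraints that define the space decouple over the faces of the mesh, and at each face they
  are an explicit linear system which the functions \<open>psi\<close> solve.

  Geometry. The incenter of a tetrahedron projects orthogonally into the relative interior of each
  facet, the foot being the tangent point of the insphere. For two tetrahedra on opposite sides of a
  common facet the segment between the incenters therefore crosses the relative interior of that
  facet (\<open>shared_face\<close>), so every split point lies in the relative interior of its face. By
  conformity distinct mesh faces of any dimension have disjoint relative interiors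
  (\<open>face_eqI\<close>), hence incenters, split points and mesh vertices never coincide, and a cell of the
  refinement is determined by its tetrahedron \<open>T\<close>, the facet \<open>F\<close> and the vertex \<open>u\<close> of \<open>F\<close> that it
  omits. Comparing distances to the facet planes shows that distinct cells have disjoint interiors
  (\<open>cell_eqI\<close>). Two cells in different tetrahedra share a facet only if \<open>F\<close> and \<open>u\<close> agree
  (\<open>share_face_across\<close>).

  Singular edges. Edges of the refinement of the other types lie on at least three face planes, while
  the edges from a split point to a vertex of its face lie on exactly two, the plane of the face and
  the plane through the two collinear incenters; so these are precisely the singular edges
  (\<open>singular_edges_WF\<close>). Around such an edge the four cells form a cycle under sharing a face, and
  every admissible labeling gives the same alternating sum up to sign. Thus the constraint at the
  edge from the split point of \<open>F\<close> to \<open>v\<close> compares the two remaining vertices of \<open>F\<close>: the values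
  (boundary face), respectively the jumps across \<open>F\<close> (interior face), are the same
  (\<open>Y_hat_iff\<close>).

  Linear algebra. With \<open>q\<^sub>j\<close> the value on the cell labeled \<open>j\<close> around an interior split point, the
  constraints read \<open>q\<^sub>1 - q\<^sub>4 = q\<^sub>2 - q\<^sub>5 = q\<^sub>3 - q\<^sub>6\<close>, and around a boundary split point
  \<open>q\<^sub>1 = q\<^sub>2 = q\<^sub>3\<close>. The functions \<open>psi\<close> satisfy them, and they are dual to the evaluations on the
  cells labeled 3 to 6 (respectively 3), which by the constraints determine the remaining values.
\<close>

section \<open>Height functions of a simplex\<close>

text \<open>A full-dimensional simplex with vertex set \<open>C\<close>, together with the facet planes: the plane of
  the facet opposite \<open>a\<close> is \<open>n a \<bullet> x = b a\<close>, where \<open>n a\<close> is the unit normal pointing out of the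
  simplex.\<close>

locale framed_simplex =
  fixes C :: "'a::euclidean_space set" and n :: "'a \<Rightarrow> 'a" and b :: "'a \<Rightarrow> real"
  assumes indep: "\<not> affine_dependent C"
    and card_C: "card C = Suc DIM('a)"
    and norm_n: "a \<in> C \<Longrightarrow> norm (n a) = 1"
    and plane: "a \<in> C \<Longrightarrow> affine hull (C - {a}) = {x. n a \<bullet> x = b a}"
    and below: "a \<in> C \<Longrightarrow> n a \<bullet> a < b a"

lemma framed_simplex_exists:
  fixes C :: "'a::euclidean_space set"
  assumes C: "\<not> affine_dependent C" "card C = Suc DIM('a)"
  shows "\<exists>n b. framed_simplex C n b"
proof -
  have "\<exists>m. norm (fst m) = 1 \<and> affine hull (C - {a}) = {x. fst m \<bullet> x = snd m} \<and> fst m \<bullet> a < snd m"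
    if a: "a \<in> C" for a
  proof -
    have "\<not> affine_dependent (C - {a})"
      using C(1) affine_independent_Diff by blast
    then have "aff_dim (C - {a}) = int (card (C - {a})) - 1"
      using aff_dim_affine_independent by fastforce
    also have "\<dots> = DIM('a) - 1"
      using a C(2) by (simp add: card_Diff_singleton)
    finally obtain m d where m: "m \<noteq> 0" "affine hull (C - {a}) = {x. m \<bullet> x = d}"
      unfolding aff_dim_eq_hyperplane by blast
    have "a \<notin> affine hull (C - {a})"
      using C(1) a affine_dependent_def by blast
    then have ne: "m \<bullet> a \<noteq> d" using m by auto
    define s where "s = (if m \<bullet> a < d then 1 else -1) / norm m"
    have s0: "s \<noteq> 0" using m by (auto simp: s_def)
    have "norm (s *\<^sub>R m) = 1" using m by (auto simp: s_def)
    moreover have "affine hull (C - {a}) = {x. (s *\<^sub>R m) \<bullet> x = s * d}"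
      using m s0 by auto
    moreover have "(s *\<^sub>R m) \<bullet> a < s * d"
      using ne m by (auto simp: s_def divide_simps)
    ultimately show ?thesis by (intro exI[of _ "(s *\<^sub>R m, s * d)"]) auto
  qed
  then obtain f where "\<forall>a\<in>C. norm (fst (f a)) = 1 \<and>
      affine hull (C - {a}) = {x. fst (f a) \<bullet> x = snd (f a)} \<and> fst (f a) \<bullet> a < snd (f a)"
    by metis
  then have "framed_simplex C (\<lambda>a. fst (f a)) (\<lambda>a. snd (f a))"
    using C by (simp add: framed_simplex_def)
  then show ?thesis by blast
qed

lemma infdist_hyperplane:
  fixes m :: "'a::euclidean_space"
  assumes "norm m = 1"
  shows "infdist x {y. m \<bullet> y = d} = \<bar>d - m \<bullet> x\<bar>"
proof (rule antisym)
  have mm: "m \<bullet> m = 1" using assms by (simp add: norm_eq_1)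
  have "x + (d - m \<bullet> x) *\<^sub>R m \<in> {y. m \<bullet> y = d}"
    by (simp add: inner_add_right mm)
  moreover have "dist x (x + (d - m \<bullet> x) *\<^sub>R m) = \<bar>d - m \<bullet> x\<bar>"
    using assms by (simp add: dist_norm)
  ultimately show "infdist x {y. m \<bullet> y = d} \<le> \<bar>d - m \<bullet> x\<bar>"
    by (metis infdist_le)
  have "{y. m \<bullet> y = d} \<noteq> {}" using \<open>x + _ \<in> _\<close> by blast
  moreover have "\<bar>d - m \<bullet> x\<bar> \<le> dist x y" if "m \<bullet> y = d" for y
  proof -
    have "\<bar>m \<bullet> (y - x)\<bar> \<le> norm m * norm (y - x)" by (rule Cauchy_Schwarz_ineq2)
    then show ?thesis using that assms by (simp add: inner_diff_right dist_norm norm_minus_commute)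
  qed
  ultimately show "\<bar>d - m \<bullet> x\<bar> \<le> infdist x {y. m \<bullet> y = d}"
    by (auto simp: infdist_notempty intro!: cINF_greatest)
qed

context framed_simplex
begin

text \<open>The signed distance to the plane of the facet opposite \<open>a\<close>, positive on the side of \<open>a\<close>; up
  to the factor \<open>height a a\<close> this is the barycentric coordinate at \<open>a\<close>.\<close>

definition height :: "'a \<Rightarrow> 'a \<Rightarrow> real" where
  "height a x = b a - n a \<bullet> x"

lemma finite_C: "finite C"
  using indep aff_independent_finite by blast

lemma height_vertex: "a \<in> C \<Longrightarrow> v \<in> C \<Longrightarrow> v \<noteq> a \<Longrightarrow> height a v = 0"
  using plane[of a] hull_inc[of v "C - {a}" affine] by (auto simp: height_def)

lemma height_self_pos: "a \<in> C \<Longrightarrow> height a a > 0"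
  using below by (simp add: height_def)

lemma height_affine:
  assumes "finite B" "sum u B = 1"
  shows "height a (\<Sum>v\<in>B. u v *\<^sub>R v) = (\<Sum>v\<in>B. u v * height a v)"
  using assms
  by (simp add: height_def inner_sum_right right_diff_distrib sum_subtractf flip: sum_distrib_right)

lemma height_comb:
  assumes a: "a \<in> C" and u: "sum u C = 1"
  shows "height a (\<Sum>v\<in>C. u v *\<^sub>R v) = u a * height a a"
proof -
  have "height a (\<Sum>v\<in>C. u v *\<^sub>R v) = (\<Sum>v\<in>C. u v * height a v)"
    by (rule height_affine[OF finite_C u])
  also have "\<dots> = (\<Sum>v\<in>C. if v = a then u a * height a a else 0)"
    by (rule sum.cong) (auto simp: height_vertex a)
  finally show ?thesis by (simp add: finite_C a)
qed

lemma barycentric: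
  obtains u where "sum u C = 1" "x = (\<Sum>v\<in>C. u v *\<^sub>R v)"
proof -
  have "aff_dim C = DIM('a)"
    using aff_dim_affine_independent[OF indep] card_C by simp
  then have "affine hull C = UNIV" using aff_dim_eq_full by blast
  then have "x \<in> affine hull C" by simp
  then show ?thesis using that by (auto simp: affine_hull_finite finite_C)
qed

lemma mem_simplex_iff: "x \<in> convex hull C \<longleftrightarrow> (\<forall>a\<in>C. height a x \<ge> 0)"
proof
  assume "x \<in> convex hull C"
  then obtain u where u: "\<forall>v\<in>C. 0 \<le> u v" "sum u C = 1" "x = (\<Sum>v\<in>C. u v *\<^sub>R v)"
    by (auto simp: convex_hull_finite finite_C)
  show "\<forall>a\<in>C. height a x \<ge> 0"
  proof
    fix a assume "a \<in> C"
    then show "height a x \<ge> 0"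
      using u height_comb[of a u] height_self_pos[of a] by simp
  qed
next
  assume R: "\<forall>a\<in>C. height a x \<ge> 0"
  obtain u where u: "sum u C = 1" "x = (\<Sum>v\<in>C. u v *\<^sub>R v)" by (rule barycentric)
  have "u a \<ge> 0" if "a \<in> C" for a
    using R that u height_comb[of a u] height_self_pos[of a] by (auto simp: zero_le_mult_iff)
  then show "x \<in> convex hull C" using u by (auto simp: convex_hull_finite finite_C)
qed

lemma mem_interior_simplex_iff: "x \<in> interior (convex hull C) \<longleftrightarrow> (\<forall>a\<in>C. height a x > 0)"
proof
  assume "x \<in> interior (convex hull C)"
  then obtain u where u: "\<forall>v\<in>C. 0 < u v" "sum u C = 1" "x = (\<Sum>v\<in>C. u v *\<^sub>R v)"
    using interior_convex_hull_explicit_minimal[OF indep] card_C by auto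
  show "\<forall>a\<in>C. height a x > 0"
  proof
    fix a assume "a \<in> C"
    then show "height a x > 0"
      using u height_comb[of a u] height_self_pos[of a] by simp
  qed
next
  assume R: "\<forall>a\<in>C. height a x > 0"
  obtain u where u: "sum u C = 1" "x = (\<Sum>v\<in>C. u v *\<^sub>R v)" by (rule barycentric)
  have "u a > 0" if "a \<in> C" for a
    using R that u height_comb[of a u] height_self_pos[of a] by (auto simp: zero_less_mult_iff)
  then show "x \<in> interior (convex hull C)"
    using u interior_convex_hull_explicit_minimal[OF indep] card_C by auto
qed

lemma mem_rel_interior_facet_iff:
  assumes w: "w \<in> C"
  shows "x \<in> rel_interior (convex hull (C - {w})) \<longleftrightarrow>
           height w x = 0 \<and> (\<forall>a\<in>C - {w}. height a x > 0)"
proof -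
  have ind: "\<not> affine_dependent (C - {w})"
    using indep affine_independent_Diff by blast
  have sumw: "sum f (C - {w}) = sum f C" if "f w = 0" for f :: "'a \<Rightarrow> 'b::comm_monoid_add"
    using w that finite_C by (simp add: sum.remove)
  show ?thesis
  proof
    assume "x \<in> rel_interior (convex hull (C - {w}))"
    then obtain u where u: "\<forall>v\<in>C - {w}. 0 < u v" "sum u (C - {w}) = 1"
        "x = (\<Sum>v\<in>C - {w}. u v *\<^sub>R v)"
      using rel_interior_convex_hull_explicit[OF ind] by auto
    define u' where "u' = u(w := 0)"
    have u': "sum u' C = 1" "x = (\<Sum>v\<in>C. u' v *\<^sub>R v)"
    proof -
      have "sum u' (C - {w}) = sum u (C - {w})"
        by (rule sum.cong) (auto simp: u'_def)
      then show "sum u' C = 1" using u sumw[of u'] by (simp add: u'_def)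
      have "(\<Sum>v\<in>C - {w}. u' v *\<^sub>R v) = (\<Sum>v\<in>C - {w}. u v *\<^sub>R v)"
        by (rule sum.cong) (auto simp: u'_def)
      then show "x = (\<Sum>v\<in>C. u' v *\<^sub>R v)" using u sumw[of "\<lambda>v. u' v *\<^sub>R v"] by (simp add: u'_def)
    qed
    have "height a x = u' a * height a a" if "a \<in> C" for a
      using height_comb[of a u'] u' that by simp
    then show "height w x = 0 \<and> (\<forall>a\<in>C - {w}. height a x > 0)"
      using w u(1) height_self_pos by (auto simp: u'_def)
  next
    assume R: "height w x = 0 \<and> (\<forall>a\<in>C - {w}. height a x > 0)"
    obtain u where u: "sum u C = 1" "x = (\<Sum>v\<in>C. u v *\<^sub>R v)" by (rule barycentric)
    have hu: "height a x = u a * height a a" if "a \<in> C" for a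
      using height_comb[of a u] u that by simp
    have "u w = 0" using hu[OF w] R height_self_pos[OF w] by simp
    moreover have "u a > 0" if "a \<in> C - {w}" for a
    proof -
      have "0 < height a x" using R that by blast
      then have "0 < u a * height a a" using hu[of a] that by simp
      then show ?thesis using height_self_pos[of a] that by (simp add: zero_less_mult_iff)
    qed
    ultimately show "x \<in> rel_interior (convex hull (C - {w}))"
      using u sumw[of u] sumw[of "\<lambda>v. u v *\<^sub>R v"] rel_interior_convex_hull_explicit[OF ind]
      by auto
  qed
qed

lemma infdist_facet_plane:
  "a \<in> C \<Longrightarrow> infdist x (affine hull (C - {a})) = \<bar>height a x\<bar>"
  using infdist_hyperplane[OF norm_n] plane by (simp add: height_def)

lemma isCont_height: "isCont (height a) x"
  unfolding height_def by (intro continuous_intros)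

text \<open>A small neighbourhood of a relative interior point of a facet lies, on the inner side of
  the plane of the facet, in the simplex: the other heights are positive near the point.\<close>

lemma facet_cap:
  assumes w: "w \<in> C" and q: "q \<in> rel_interior (convex hull (C - {w}))"
  shows "\<exists>\<delta>>0. \<forall>x\<in>ball q \<delta>. n w \<bullet> x \<le> b w \<longrightarrow> x \<in> convex hull C"
proof -
  have "\<forall>\<^sub>F x in nhds q. \<forall>a\<in>C - {w}. height a x > 0"
  proof (intro eventually_ball_finite ballI)
    fix a assume "a \<in> C - {w}"
    then have "height a q > 0" using q mem_rel_interior_facet_iff[OF w] by blast
    moreover have "(height a \<longlongrightarrow> height a q) (nhds q)"
      using isCont_height by (simp add: isCont_def tendsto_at_iff_tendsto_nhds)
    ultimately show "\<forall>\<^sub>F x in nhds q. height a x > 0"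
      by (rule order_tendstoD[rotated])
  qed (simp add: finite_C)
  then obtain \<delta> where "\<delta> > 0" and d: "\<forall>x\<in>ball q \<delta>. \<forall>a\<in>C - {w}. height a x > 0"
    unfolding eventually_nhds_metric by (auto simp: dist_commute)
  moreover have "height w x \<ge> 0" if "n w \<bullet> x \<le> b w" for x
    using that by (simp add: height_def)
  ultimately have "\<forall>x\<in>ball q \<delta>. n w \<bullet> x \<le> b w \<longrightarrow> x \<in> convex hull C"
    unfolding mem_simplex_iff by (metis Diff_iff less_imp_le singletonD)
  then show ?thesis using \<open>\<delta> > 0\<close> by blast
qed

lemma normals_distinct:
  assumes dim: "DIM('a) \<ge> 2" and aw: "a \<in> C" "w \<in> C" "a \<noteq> w"
  shows "n a \<bullet> n w < 1"
proof -
  have "n a \<noteq> n w"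
  proof
    assume eq: "n a = n w"
    \<comment> \<open>a third vertex lies on both planes, which then coincide\<close>
    have "card (C - {a, w}) > 0"
      using dim aw card_C by (simp add: card_Diff_subset finite_C)
    then obtain v where v: "v \<in> C" "v \<noteq> a" "v \<noteq> w" by (auto simp: card_gt_0_iff)
    have "height a v = 0" "height w v = 0" using v aw by (auto intro: height_vertex)
    then have "height a a = height w a" using eq by (simp add: height_def)
    then show False using height_vertex[of w a] height_self_pos[of a] aw by simp
  qed
  moreover have "norm (n a - n w) ^ 2 = 2 - 2 * (n a \<bullet> n w)"
    using norm_n[of a] norm_n[of w] aw
    by (simp add: power2_norm_eq_inner algebra_simps inner_commute norm_eq_1)
  moreover have "norm (n a - n w) ^ 2 > 0" using \<open>n a \<noteq> n w\<close> by simp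
  ultimately show ?thesis by linarith
qed

text \<open>The point at equal distance from all facet planes has barycentric coordinates proportional
  to the reciprocals of the heights of the simplex.\<close>

lemma equidistant_exists:
  obtains c r where "r > 0" "\<forall>a\<in>C. height a c = r"
proof -
  define S where "S = (\<Sum>a\<in>C. 1 / height a a)"
  have "C \<noteq> {}" using card_C by auto
  then have S: "S > 0"
    unfolding S_def by (intro sum_pos) (auto simp: finite_C height_self_pos)
  define u where "u a = 1 / height a a / S" for a
  have "sum u C = 1"
    unfolding u_def sum_divide_distrib[symmetric] S_def[symmetric] using S by simp
  then have "height a (\<Sum>v\<in>C. u v *\<^sub>R v) = 1 / S" if "a \<in> C" for a
    using height_comb[OF that] height_self_pos[OF that] by (simp add: u_def)
  then show ?thesis using that[of "1/S" "\<Sum>v\<in>C. u v *\<^sub>R v"] S by simp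
qed

lemma equidistant_unique:
  assumes c: "\<forall>a\<in>C. height a c = r" and c': "\<forall>a\<in>C. height a c' = r'"
  shows "c = c'"
proof -
  obtain u where u: "sum u C = 1" "c = (\<Sum>v\<in>C. u v *\<^sub>R v)" by (rule barycentric)
  obtain u' where u': "sum u' C = 1" "c' = (\<Sum>v\<in>C. u' v *\<^sub>R v)" by (rule barycentric)
  have eq: "u a = r * (1 / height a a)" "u' a = r' * (1 / height a a)" if "a \<in> C" for a
    using height_comb[OF that u(1)] height_comb[OF that u'(1)] height_self_pos[OF that]
      c c' that u(2) u'(2) by (auto simp: field_simps)
  have "r * (\<Sum>a\<in>C. 1 / height a a) = 1" "r' * (\<Sum>a\<in>C. 1 / height a a) = 1"
    using u(1) u'(1) eq by (simp_all add: sum_distrib_left)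
  then have "r = r'"
    by (metis mult_cancel_right zero_neq_one mult_zero_right)
  then show ?thesis using eq u u' by simp
qed

end

section \<open>The incenter of a tetrahedron\<close>

lemma incenter_framed:
  fixes C :: "point set"
  assumes "framed_simplex C n b"
  obtains r where "r > 0" "\<forall>a\<in>C. framed_simplex.height n b a (incenter (convex hull C)) = r"
proof -
  interpret framed_simplex C n b by fact
  have facets: "F facet_of (convex hull C) \<longleftrightarrow> (\<exists>a\<in>C. F = convex hull (C - {a}))" for F
    using facet_of_convex_hull_affine_independent_alt[OF indep] card_C by auto
  have iff: "(\<exists>r. \<forall>F. F facet_of (convex hull C) \<longrightarrow> infdist c (affine hull F) = r) \<longleftrightarrow>
      (\<exists>r. \<forall>a\<in>C. height a c = r)" if "c \<in> interior (convex hull C)" for c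
  proof -
    have "infdist c (affine hull (convex hull (C - {a}))) = height a c" if "a \<in> C" for a
    proof -
      have "height a c > 0" using \<open>c \<in> _\<close> that by (simp add: mem_interior_simplex_iff)
      then show ?thesis using that by (simp add: infdist_facet_plane)
    qed
    then show ?thesis unfolding facets by (metis (no_types))
  qed
  obtain c r where c: "r > 0" "\<forall>a\<in>C. height a c = r" by (rule equidistant_exists)
  have "incenter (convex hull C) = c"
    unfolding incenter_def
  proof (rule the_equality)
    show "c \<in> interior (convex hull C) \<and>
      (\<exists>r. \<forall>F. F facet_of convex hull C \<longrightarrow> infdist c (affine hull F) = r)"
      using c iff[of c] by (auto simp: mem_interior_simplex_iff)
    show "x = c" if "x \<in> interior (convex hull C) \<and>
      (\<exists>r. \<forall>F. F facet_of convex hull C \<longrightarrow> infdist x (affine hull F) = r)" for x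
      using that iff[of x] c(2) equidistant_unique by blast
  qed
  then show ?thesis using that c by blast
qed

text \<open>What is needed of a tetrahedron \<open>T\<close> near a facet \<open>F\<close> with outer unit normal \<open>m\<close>: the incenter
  lies over a point \<open>p\<close> of the relative interior of \<open>F\<close> (the tangent point of the insphere), and
  near the relative interior of \<open>F\<close> the half-space below \<open>F\<close> is contained in \<open>T\<close>.\<close>

lemma tetrahedron_facet:
  fixes T F :: "point set"
  assumes T: "3 simplex T" and F: "F facet_of T"
  obtains m d r p where "norm m = 1" "affine hull F = {x. m \<bullet> x = d}" "r > 0"
    "p \<in> rel_interior F" "incenter T = p - r *\<^sub>R m"
    "interior T \<subseteq> {x. m \<bullet> x < d}"
    "\<And>q. q \<in> rel_interior F \<Longrightarrow> \<exists>\<delta>>0. \<forall>x\<in>ball q \<delta>. m \<bullet> x \<le> d \<longrightarrow> x \<in> T"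
proof -
  obtain C where C: "\<not> affine_dependent C" "card C = 4" "T = convex hull C"
    using T by (auto simp: simplex_def)
  then obtain n b where fs: "framed_simplex C n b"
    using framed_simplex_exists[of C] by auto
  interpret framed_simplex C n b by fact
  obtain w where w: "w \<in> C" "F = convex hull (C - {w})"
    using F facet_of_convex_hull_affine_independent_alt[OF indep] C(3) by auto
  obtain r where r: "r > 0" "\<forall>a\<in>C. height a (incenter T) = r"
    using incenter_framed[OF fs] C(3) by blast
  define p where "p = incenter T + r *\<^sub>R n w"
  have "height a p = r - r * (n a \<bullet> n w)" if "a \<in> C" for a
    using r(2) that by (simp add: p_def height_def inner_add_right)
  moreover have "n w \<bullet> n w = 1" using norm_n w by (simp add: norm_eq_1)
  ultimately have "p \<in> rel_interior F"
    unfolding w(2) mem_rel_interior_facet_iff[OF w(1)]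
    using normals_distinct w(1) r(1) by auto
  moreover have "interior T \<subseteq> {x. n w \<bullet> x < b w}"
    using w(1) unfolding C(3) by (auto simp: mem_interior_simplex_iff height_def)
  ultimately show ?thesis
    using that[of "n w" "b w" r p] norm_n[OF w(1)] plane[OF w(1)] w r(1) facet_cap[OF w(1)] C(3)
    by (simp add: p_def)
qed

lemma incenter_interior:
  fixes T :: "point set"
  assumes "3 simplex T"
  shows "incenter T \<in> interior T"
proof -
  obtain C where C: "\<not> affine_dependent C" "card C = 4" "T = convex hull C"
    using assms by (auto simp: simplex_def)
  then obtain n b where fs: "framed_simplex C n b"
    using framed_simplex_exists[of C] by auto
  then interpret framed_simplex C n b .
  show ?thesis
    using incenter_framed[OF fs] C(3) by (metis mem_interior_simplex_iff)
qed

section \<open>Sub-tetrahedra of a split simplex\<close>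

context framed_simplex
begin

text \<open>The vertices of a cell of the refinement are affinely independent: \<open>c\<close> is the incenter (any
  interior point), \<open>z\<close> the split point of the facet opposite \<open>w\<close>, and \<open>C - {w, u}\<close> an edge of that
  facet.\<close>

lemma aff_independent_split:
  assumes w: "w \<in> C" and u: "u \<in> C - {w}" and c: "c \<in> interior (convex hull C)"
    and z: "z \<in> rel_interior (convex hull (C - {w}))"
  shows "\<not> affine_dependent (insert c (insert z (C - {w, u})))"
    and "c \<notin> affine hull (convex hull (C - {w}))"
    and "z \<notin> affine hull (C - {w, u})"
proof -
  have "u \<in> C" "u \<noteq> w" using u by auto
  have "height w c > 0" using c w mem_interior_simplex_iff by blast
  then show c': "c \<notin> affine hull (convex hull (C - {w}))"
    using plane[OF w] by (simp add: height_def)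
  have "height u z > 0" using z u mem_rel_interior_facet_iff[OF w] by blast
  moreover have "affine hull (C - {w, u}) \<subseteq> affine hull (C - {u})"
    by (intro hull_mono) auto
  ultimately show z': "z \<notin> affine hull (C - {w, u})"
    using plane[OF \<open>u \<in> C\<close>] by (auto simp: height_def)
  have "\<not> affine_dependent (C - {w, u})"
    using indep affine_independent_Diff by blast
  then have "\<not> affine_dependent (insert z (C - {w, u}))"
    using z' affine_independent_insert by blast
  moreover have "insert z (C - {w, u}) \<subseteq> affine hull (C - {w})"
    using z rel_interior_subset convex_hull_subset_affine_hull hull_subset[of "C - {w}" affine] by blast
  then have "affine hull (insert z (C - {w, u})) \<subseteq> affine hull (C - {w})"
    by (simp add: hull_minimal)
  ultimately show "\<not> affine_dependent (insert c (insert z (C - {w, u})))"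
    using c' affine_independent_insert by (metis affine_hull_convex_hull subsetD)
qed

text \<open>A point \<open>x\<close> in the open cell at the facet opposite \<open>w\<close> lies closest to that facet, and among
  the vertices \<open>a\<close> of the facet the omitted one, \<open>u\<close>, has the smallest excess of \<open>height a x\<close> over
  \<open>height w x\<close>, relative to the height of \<open>z\<close>. Hence \<open>x\<close> determines \<open>w\<close> and then \<open>u\<close>.\<close>

lemma split_cell_heights:
  assumes w: "w \<in> C" and u: "u \<in> C - {w}" and c: "\<forall>a\<in>C. height a c = r" "r > 0"
    and z: "z \<in> rel_interior (convex hull (C - {w}))"
    and x: "x \<in> interior (convex hull (insert c (insert z (C - {w, u}))))"
  shows "\<forall>a\<in>C - {w}. height w x < height a x"
    and "\<forall>a\<in>C - {w, u}. (height u x - height w x) / height u z < (height a x - height w x) / height a z"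
proof -
  let ?E = "C - {w, u}"
  have hz: "height w z = 0" "\<And>a. a \<in> C - {w} \<Longrightarrow> height a z > 0"
    using z mem_rel_interior_facet_iff[OF w] by blast+
  have cint: "c \<in> interior (convex hull C)" using c by (simp add: mem_interior_simplex_iff)
  note ind = aff_independent_split[OF w u cint z]
  have "z \<notin> ?E" using ind(3) hull_inc by metis
  have "insert z ?E \<subseteq> affine hull (convex hull (C - {w}))"
    using z rel_interior_subset hull_subset[of "convex hull (C - {w})" affine]
      hull_subset[of "C - {w}" convex] by blast
  then have "c \<notin> insert z ?E" using ind(2) by blast
  let ?W = "insert c (insert z ?E)"
  obtain \<mu> where m: "\<forall>v\<in>?W. 0 < \<mu> v" "sum \<mu> ?W = 1" "x = (\<Sum>v\<in>?W. \<mu> v *\<^sub>R v)"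
    using x interior_convex_hull_explicit_minimal[OF ind(1)] by (auto split: if_splits)
  have "height a x = (\<Sum>v\<in>?W. \<mu> v * height a v)" for a
    unfolding m(3) by (rule height_affine) (use m(2) finite_C in auto)
  then have hx: "height a x = \<mu> c * height a c + \<mu> z * height a z + (\<Sum>v\<in>?E. \<mu> v * height a v)" for a
    using \<open>z \<notin> ?E\<close> \<open>c \<notin> insert z ?E\<close> finite_C by simp
  have sum0: "(\<Sum>v\<in>?E. \<mu> v * height a v) = 0" if "a \<in> {w, u}" for a
    using that w u by (intro sum.neutral) (auto simp: height_vertex)
  have suma: "(\<Sum>v\<in>?E. \<mu> v * height a v) = \<mu> a * height a a" if "a \<in> ?E" for a
  proof -
    have "(\<Sum>v\<in>?E. \<mu> v * height a v) = (\<Sum>v\<in>?E. if v = a then \<mu> a * height a a else 0)"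
      using that by (intro sum.cong) (auto simp: height_vertex)
    then show ?thesis using that finite_C by simp
  qed
  have hw: "height w x = \<mu> c * r" using hx[of w] sum0[of w] hz(1) c w by simp
  have hu: "height u x = \<mu> c * r + \<mu> z * height u z" using hx[of u] sum0[of u] c u by simp
  have ha: "height a x = \<mu> c * r + \<mu> z * height a z + \<mu> a * height a a" if "a \<in> ?E" for a
    using hx[of a] suma[OF that] c that by simp
  have pos: "\<mu> c > 0" "\<mu> z > 0" using m by auto
  have posa: "\<mu> a * height a a > 0" if "a \<in> ?E" for a
    using m(1) that height_self_pos[of a] by simp
  show "\<forall>a\<in>C - {w}. height w x < height a x"
  proof
    fix a assume a: "a \<in> C - {w}"
    have "\<mu> z * height a z > 0" using hz(2)[OF a] pos by simp
    then show "height w x < height a x"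
      using hw hu ha[of a] posa[of a] a by (cases "a = u") auto
  qed
  show "\<forall>a\<in>?E. (height u x - height w x) / height u z < (height a x - height w x) / height a z"
  proof
    fix a assume a: "a \<in> ?E"
    have za: "height a z > 0" "height u z > 0" using hz(2)[of a] hz(2)[of u] a u by auto
    have "(height u x - height w x) / height u z = \<mu> z" using hw hu za by simp
    moreover have "(height a x - height w x) / height a z = \<mu> z + \<mu> a * height a a / height a z"
      using hw ha[OF a] za by (simp add: field_simps)
    moreover have "\<mu> a * height a a / height a z > 0" using posa[OF a] za by simp
    ultimately show "(height u x - height w x) / height u z < (height a x - height w x) / height a z"
      by linarith
  qed
qed

end

section \<open>Faces of simplices\<close>

text \<open>The vertex set of a simplex, as its set of extreme points.\<close>

definition verts :: "point set \<Rightarrow> point set" where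
  "verts X = {v. v extreme_point_of X}"

lemma verts_simplex: "\<not> affine_dependent V \<Longrightarrow> verts (convex hull V) = V"
  by (simp add: verts_def extreme_point_of_convex_hull_affine_independent)

lemma edge_of_simplex_iff:
  fixes V :: "point set"
  assumes V: "\<not> affine_dependent V"
  shows "e edge_of convex hull V \<longleftrightarrow>
    (\<exists>p q. p \<in> V \<and> q \<in> V \<and> p \<noteq> q \<and> e = convex hull {p, q})"
proof
  assume "e edge_of convex hull V"
  then obtain c where c: "c \<subseteq> V" "e = convex hull c" "aff_dim e = 1"
    using face_of_convex_hull_affine_independent[OF V] by (auto simp: edge_of_def)
  have "\<not> affine_dependent c" using V c affine_dependent_subset by blast
  then have "card c = 2" using aff_dim_affine_independent[of c] c by (simp add: aff_dim_convex_hull)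
  then obtain p q where "c = {p, q}" "p \<noteq> q" by (auto simp: card_2_iff)
  then show "\<exists>p q. p \<in> V \<and> q \<in> V \<and> p \<noteq> q \<and> e = convex hull {p, q}" using c by blast
next
  assume "\<exists>p q. p \<in> V \<and> q \<in> V \<and> p \<noteq> q \<and> e = convex hull {p, q}"
  then obtain p q where pq: "p \<in> V" "q \<in> V" "p \<noteq> q" "e = convex hull {p, q}" by blast
  then have "e face_of convex hull V"
    using face_of_convex_hull_affine_independent[OF V] by (metis empty_subsetI insert_subset)
  then show "e edge_of convex hull V" using pq by (simp add: edge_of_def aff_dim_convex_hull)
qed

lemma tetrahedron_facet_verts:
  fixes T F :: "point set"
  assumes T: "3 simplex T" and F: "F facet_of T"
  obtains C w where "\<not> affine_dependent C" "card C = 4" "T = convex hull C" "verts T = C"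
    "w \<in> C" "F = convex hull (C - {w})" "verts F = C - {w}" "\<not> affine_dependent (C - {w})"
proof -
  obtain C where C: "\<not> affine_dependent C" "card C = 4" "T = convex hull C"
    using T by (auto simp: simplex_def)
  obtain w where w: "w \<in> C" "F = convex hull (C - {w})"
    using F facet_of_convex_hull_affine_independent_alt[OF C(1)] C(3) by auto
  have "\<not> affine_dependent (C - {w})" using C(1) affine_independent_Diff by blast
  then show ?thesis using that C w by (simp add: verts_simplex)
qed

lemma hyperplane_unit_normals:
  fixes m m' :: "'a::euclidean_space"
  assumes "norm m = 1" "norm m' = 1" and eq: "{x. m \<bullet> x = d} = {x. m' \<bullet> x = d'}"
  shows "m' = m \<and> d' = d \<or> m' = - m \<and> d' = - d"
proof -
  have mm: "m \<bullet> m = 1" "m' \<bullet> m' = 1" using assms by (simp_all add: norm_eq_1)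
  define s where "s = m \<bullet> m'"
  have on: "m' \<bullet> x = d'" if "m \<bullet> x = d" for x using eq that by blast
  have d': "d * s = d'" using on[of "d *\<^sub>R m"] mm by (simp add: s_def inner_commute)
  have "m' \<bullet> (d *\<^sub>R m + (m' - s *\<^sub>R m)) = d'"
    by (rule on) (simp add: inner_add_right inner_diff_right mm s_def)
  then have ss: "1 - s * s = 0"
    using d' mm by (simp add: inner_add_right inner_diff_right s_def inner_commute)
  have "(m' - s *\<^sub>R m) \<bullet> (m' - s *\<^sub>R m) = 1 - s * s"
    using mm by (simp add: inner_diff_left inner_diff_right s_def inner_commute)
  then have "m' = s *\<^sub>R m" using ss by simp
  moreover have "s = 1 \<or> s = -1" using ss by (simp add: square_eq_1_iff)
  ultimately show ?thesis using d' by auto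
qed

section \<open>Conforming tetrahedral meshes\<close>

text \<open>A polyhedral domain with a conforming mesh of tetrahedra.\<close>

locale wf_mesh =
  fixes \<Omega> :: "point set" and \<T> :: "point set set"
  assumes domain: "polyhedral_domain \<Omega>" and mesh: "tet_mesh \<Omega> \<T>"
begin

lemma finite_mesh: "finite \<T>"
  and simplex_mesh: "T \<in> \<T> \<Longrightarrow> 3 simplex T"
  and Int_face: "T \<in> \<T> \<Longrightarrow> T' \<in> \<T> \<Longrightarrow> (T \<inter> T') face_of T"
  and Union_mesh: "\<Union>\<T> = closure \<Omega>"
  using mesh by (auto simp: tet_mesh_def triangulation_def)

lemma open_domain: "open \<Omega>" and interior_closure_domain: "interior (closure \<Omega>) = \<Omega>"
  using domain by (auto simp: polyhedral_domain_def)

lemma aff_dim_mesh: "T \<in> \<T> \<Longrightarrow> aff_dim T = 3"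
  using simplex_mesh aff_dim_simplex by blast

lemma aff_dim_mesh_face: "T \<in> \<T> \<Longrightarrow> F facet_of T \<Longrightarrow> aff_dim F = 2"
  using aff_dim_mesh by (simp add: facet_of_def)

lemma convex_mesh: "T \<in> \<T> \<Longrightarrow> convex T"
  using simplex_mesh convex_simplex by blast

lemma rel_interior_mesh: "T \<in> \<T> \<Longrightarrow> rel_interior T = interior T"
  using simplex_mesh incenter_interior rel_interior_nonempty_interior by blast

text \<open>Conformity in the form used throughout: a tetrahedron meeting the relative interior of a
  mesh face has that face among its own faces; hence distinct mesh faces, of any dimensions, have
  disjoint relative interiors.\<close>

lemma face_of_if_meets:
  assumes "T \<in> \<T>" "T' \<in> \<T>" "X face_of T" "x \<in> rel_interior X" "x \<in> T'"
  shows "X face_of T'"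
proof -
  have "x \<in> T" using assms rel_interior_subset face_of_imp_subset by blast
  then have "X \<subseteq> T \<inter> T'"
    using assms by (intro subset_of_face_of[OF Int_face[of T T']] face_of_imp_subset) auto
  then have "X face_of (T' \<inter> T)"
    using face_of_subset[OF assms(3)] by (simp add: Int_commute)
  then show ?thesis using Int_face[of T' T] assms face_of_trans by blast
qed

lemma face_eqI:
  assumes "T \<in> \<T>" "T' \<in> \<T>" "X face_of T" "X' face_of T'"
    and "x \<in> rel_interior X" "x \<in> rel_interior X'"
  shows "X = X'"
proof -
  have "x \<in> T'" using assms rel_interior_subset face_of_imp_subset by blast
  then have "X face_of T'" using assms face_of_if_meets by blast
  then show ?thesis using face_of_eq assms by blast
qed

lemma mesh_eqI:
  assumes "T \<in> \<T>" "T' \<in> \<T>" "x \<in> interior T" "x \<in> T'"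
  shows "T = T'"
proof -
  have "T face_of T'"
  proof (rule face_of_if_meets)
    show "T face_of T" using assms convex_mesh face_of_refl by blast
    show "x \<in> rel_interior T" using assms rel_interior_mesh by blast
  qed (use assms in auto)
  moreover have "\<not> aff_dim T < aff_dim T'" using assms aff_dim_mesh by simp
  ultimately show ?thesis using face_of_aff_dim_lt convex_mesh assms by blast
qed

text \<open>If the outer normals of two tetrahedra on a common facet agreed, both tetrahedra would contain
  a half ball on the same side of the facet.\<close>

lemma mesh_face_opposite_normals:
  assumes T: "T1 \<in> \<T>" "T2 \<in> \<T>" "T1 \<noteq> T2" and F: "F facet_of T1" "F facet_of T2"
    and m: "norm m1 = 1" "norm m2 = 1" "affine hull F = {x. m1 \<bullet> x = d1}" "affine hull F = {x. m2 \<bullet> x = d2}"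
    and cap1: "\<And>q. q \<in> rel_interior F \<Longrightarrow> \<exists>\<delta>>0. \<forall>x\<in>ball q \<delta>. m1 \<bullet> x \<le> d1 \<longrightarrow> x \<in> T1"
    and cap2: "\<And>q. q \<in> rel_interior F \<Longrightarrow> \<exists>\<delta>>0. \<forall>x\<in>ball q \<delta>. m2 \<bullet> x \<le> d2 \<longrightarrow> x \<in> T2"
  shows "m2 = - m1 \<and> d2 = - d1"
proof (rule ccontr)
  assume "\<not> ?thesis"
  then have eq: "m2 = m1" "d2 = d1"
    using hyperplane_unit_normals[of m1 m2 d1 d2] m by auto
  have "convex F" "F \<noteq> {}"
    using F face_of_imp_convex by (auto simp: facet_of_def)
  then obtain q where q: "q \<in> rel_interior F" using rel_interior_eq_empty by blast
  obtain \<delta>1 where d1: "\<delta>1 > 0" "\<forall>x\<in>ball q \<delta>1. m1 \<bullet> x \<le> d1 \<longrightarrow> x \<in> T1" using cap1[OF q] by blast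
  obtain \<delta>2 where d2: "\<delta>2 > 0" "\<forall>x\<in>ball q \<delta>2. m2 \<bullet> x \<le> d2 \<longrightarrow> x \<in> T2" using cap2[OF q] by blast
  define \<delta> where "\<delta> = min \<delta>1 \<delta>2"
  define U where "U = ball q \<delta> \<inter> {x. m1 \<bullet> x < d1}"
  have "open U" unfolding U_def by (intro open_Int open_ball open_halfspace_lt)
  have "U \<subseteq> T1" "U \<subseteq> T2" using d1(2) d2(2) unfolding eq by (auto simp: U_def \<delta>_def)
  have "\<delta> > 0" using d1(1) d2(1) by (simp add: \<delta>_def)
  have "q \<in> affine hull F" using rel_interior_subset hull_inc q by (metis subsetD)
  then have "m1 \<bullet> q = d1" using m(3) by simp
  moreover have "m1 \<bullet> m1 = 1" using m(1) by (simp add: norm_eq_1)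
  ultimately have "q - (\<delta>/2) *\<^sub>R m1 \<in> U"
    using m(1) \<open>\<delta> > 0\<close> by (simp add: U_def dist_norm inner_diff_right)
  then have "q - (\<delta>/2) *\<^sub>R m1 \<in> interior T1 \<and> q - (\<delta>/2) *\<^sub>R m1 \<in> T2"
    using interiorI[OF \<open>open U\<close> _ \<open>U \<subseteq> T1\<close>] \<open>U \<subseteq> T2\<close> by (simp add: subsetD)
  then show False using mesh_eqI T by blast
qed

text \<open>A face shared by two tetrahedra is crossed by the segment joining their incenters: both
  incenters project orthogonally into the relative interior of the face, and they lie on opposite
  sides of it.\<close>

lemma shared_face:
  assumes T: "T1 \<in> \<T>" "T2 \<in> \<T>" "T1 \<noteq> T2" and F: "F facet_of T1" "F facet_of T2"
  shows "rel_interior F \<subseteq> \<Omega>"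
    and "\<exists>z. z \<in> rel_interior F \<and> z \<in> open_segment (incenter T1) (incenter T2) \<and>
          closed_segment (incenter T1) (incenter T2) \<inter> F = {z}"
    and "T3 \<in> \<T> \<Longrightarrow> F facet_of T3 \<Longrightarrow> T3 = T1 \<or> T3 = T2"
proof -
  obtain m d r p where 1: "norm m = 1" "affine hull F = {x. m \<bullet> x = d}" "r > 0"
    "p \<in> rel_interior F" "incenter T1 = p - r *\<^sub>R m"
    "\<And>q. q \<in> rel_interior F \<Longrightarrow> \<exists>\<delta>>0. \<forall>x\<in>ball q \<delta>. m \<bullet> x \<le> d \<longrightarrow> x \<in> T1"
    using tetrahedron_facet[OF simplex_mesh[OF T(1)] F(1)] by metis
  obtain m' d' r' p' where 2: "norm m' = 1" "affine hull F = {x. m' \<bullet> x = d'}" "r' > 0"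
    "p' \<in> rel_interior F" "incenter T2 = p' - r' *\<^sub>R m'"
    "\<And>q. q \<in> rel_interior F \<Longrightarrow> \<exists>\<delta>>0. \<forall>x\<in>ball q \<delta>. m' \<bullet> x \<le> d' \<longrightarrow> x \<in> T2"
    using tetrahedron_facet[OF simplex_mesh[OF T(2)] F(2)] by metis
  have opp: "m' = - m" "d' = - d"
    using mesh_face_opposite_normals[OF T F 1(1) 2(1) 1(2) 2(2) 1(6) 2(6)] by auto
  show "rel_interior F \<subseteq> \<Omega>"
  proof
    fix q assume q: "q \<in> rel_interior F"
    obtain \<delta>1 where d1: "\<delta>1 > 0" "\<forall>x\<in>ball q \<delta>1. m \<bullet> x \<le> d \<longrightarrow> x \<in> T1" using 1(6)[OF q] by blast
    obtain \<delta>2 where d2: "\<delta>2 > 0" "\<forall>x\<in>ball q \<delta>2. m' \<bullet> x \<le> d' \<longrightarrow> x \<in> T2" using 2(6)[OF q] by blast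
    have "ball q (min \<delta>1 \<delta>2) \<subseteq> T1 \<union> T2"
    proof
      fix x assume "x \<in> ball q (min \<delta>1 \<delta>2)"
      then show "x \<in> T1 \<union> T2" using d1(2) d2(2) opp by (cases "m \<bullet> x \<le> d") auto
    qed
    also have "\<dots> \<subseteq> closure \<Omega>" using Union_mesh T by blast
    finally have "q \<in> interior (closure \<Omega>)"
      using d1 d2 by (intro interiorI[OF open_ball]) auto
    then show "q \<in> \<Omega>" using interior_closure_domain by simp
  qed
  have on: "m \<bullet> x = d" if "x \<in> F" for x
    using hull_inc[OF that, of affine] unfolding 1(2) by simp
  have pF: "m \<bullet> p = d" "m \<bullet> p' = d"
    using on[OF subsetD[OF rel_interior_subset]] 1(4) 2(4) by auto
  have mm: "m \<bullet> m = 1" using 1(1) by (simp add: norm_eq_1)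
  let ?c = "incenter T1" and ?c' = "incenter T2"
  \<comment> \<open>the crossing point divides the segment in the ratio of the inradii\<close>
  define t where "t = r / (r + r')"
  have t: "0 < t" "t < 1" "r * (1 - t) = r' * t"
    using 1(3) 2(3) by (simp_all add: t_def field_simps)
  define z where "z = (1 - t) *\<^sub>R p + t *\<^sub>R p'"
  have "convex (rel_interior F)"
    using F face_of_imp_convex convex_rel_interior by (auto simp: facet_of_def)
  then have zri: "z \<in> rel_interior F"
    using 1(4) 2(4) t unfolding z_def by (intro convexD) auto
  have c: "?c = p - r *\<^sub>R m" "?c' = p' + r' *\<^sub>R m" using 1(5) 2(5) opp by auto
  have seg: "(1 - s) *\<^sub>R ?c + s *\<^sub>R ?c' = (1 - s) *\<^sub>R p + s *\<^sub>R p' + (r' * s - r * (1 - s)) *\<^sub>R m" for s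
    unfolding c by (simp add: algebra_simps)
  have zs: "z = (1 - t) *\<^sub>R ?c + t *\<^sub>R ?c'" using seg[of t] t(3) by (simp add: z_def)
  have "m \<bullet> ?c = d - r" "m \<bullet> ?c' = d + r'"
    unfolding c by (simp_all add: inner_diff_right inner_add_right pF mm)
  then have "?c \<noteq> ?c'" using 1(3) 2(3) by auto
  then have zo: "z \<in> open_segment ?c ?c'"
    using zs t by (auto simp: in_segment)
  have "x = z" if x: "x \<in> closed_segment ?c ?c'" "x \<in> F" for x
  proof -
    obtain s where s: "x = (1 - s) *\<^sub>R ?c + s *\<^sub>R ?c'" using x by (auto simp: in_segment)
    have "m \<bullet> x = d + (r' * s - r * (1 - s))"
      unfolding s seg by (simp add: inner_add_right pF mm) (simp add: algebra_simps)
    then have "r' * s = r * (1 - s)" using on x by simp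
    then have "s = t" using 1(3) 2(3) by (simp add: t_def field_simps)
    then show ?thesis using s zs by simp
  qed
  moreover have "z \<in> F" using zri rel_interior_subset by blast
  ultimately have "closed_segment ?c ?c' \<inter> F = {z}"
    using zo by (auto simp: open_segment_def)
  then show "\<exists>z. z \<in> rel_interior F \<and> z \<in> open_segment ?c ?c' \<and> closed_segment ?c ?c' \<inter> F = {z}"
    using zri zo by blast
  show "T3 = T1 \<or> T3 = T2" if T3: "T3 \<in> \<T>" "F facet_of T3"
  proof (rule ccontr)
    assume "\<not> ?thesis"
    then have ne: "T1 \<noteq> T3" "T2 \<noteq> T3" by auto
    obtain m3 d3 where 3: "norm m3 = 1" "affine hull F = {x. m3 \<bullet> x = d3}"
      "\<And>q. q \<in> rel_interior F \<Longrightarrow> \<exists>\<delta>>0. \<forall>x\<in>ball q \<delta>. m3 \<bullet> x \<le> d3 \<longrightarrow> x \<in> T3"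
      using tetrahedron_facet[OF simplex_mesh[OF T3(1)] T3(2)] by metis
    have "m3 = - m"
      using mesh_face_opposite_normals[OF T(1) T3(1) ne(1) F(1) T3(2) 1(1) 3(1) 1(2) 3(2) 1(6) 3(3)] by auto
    moreover have "m3 = - m'"
      using mesh_face_opposite_normals[OF T(2) T3(1) ne(2) F(2) T3(2) 2(1) 3(1) 2(2) 3(2) 2(6) 3(3)] by auto
    ultimately have "m = 0" using opp(1) by (simp add: eq_neg_iff_add_eq_0 flip: scaleR_2)
    then show False using 1(1) by simp
  qed
qed

text \<open>Near the relative interior of a facet that belongs to only one tetrahedron there are no points
  of the domain beyond the facet: such points arbitrarily close to it would lie in another
  tetrahedron, which by conformity would have the facet as its own.\<close>

lemma unshared_face:
  assumes T: "T \<in> \<T>" "F facet_of T" and only: "\<And>T'. T' \<in> \<T> \<Longrightarrow> F facet_of T' \<Longrightarrow> T' = T"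
  shows "F \<subseteq> frontier \<Omega>"
proof -
  obtain m d where m: "norm m = 1" "affine hull F = {x. m \<bullet> x = d}" "interior T \<subseteq> {x. m \<bullet> x < d}"
    using tetrahedron_facet[OF simplex_mesh[OF T(1)] T(2)] by metis
  have "closed T'" if "T' \<in> \<T>" for T' using that simplex_mesh closed_simplex by blast
  have F: "F face_of T" "convex F" using T face_of_imp_convex by (auto simp: facet_of_def)
  have "closed F" using F(1) T face_of_imp_closed convex_mesh simplex_mesh closed_simplex
    by (metis)
  have Tsub: "m \<bullet> x \<le> d" if "x \<in> T" for x
  proof -
    have "T \<subseteq> closure (interior T)"
      using convex_closure_interior[OF convex_mesh[OF T(1)]] incenter_interior[OF simplex_mesh[OF T(1)]]
        closure_subset by blast
    also have "\<dots> \<subseteq> {x. m \<bullet> x \<le> d}"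
      by (rule closure_minimal) (use m(3) in \<open>auto intro: closed_halfspace_le\<close>)
    finally show ?thesis using that by blast
  qed
  have "rel_interior F \<subseteq> frontier \<Omega>"
  proof
    fix q assume q: "q \<in> rel_interior F"
    have qT: "q \<in> T" using q rel_interior_subset face_of_imp_subset F by blast
    have mq: "m \<bullet> q = d"
      using hull_inc[OF subsetD[OF rel_interior_subset q], of affine] unfolding m(2) by simp
    have "q \<notin> \<Omega>"
    proof
      assume "q \<in> \<Omega>"
      define R where "R = \<Union>(\<T> - {T})"
      have "closed R" unfolding R_def using finite_mesh \<open>\<And>T'. T' \<in> \<T> \<Longrightarrow> closed T'\<close> by blast
      have "\<exists>x\<in>R. dist x q < e" if "e > 0" for e
      proof -
        obtain e' where e': "e' > 0" "ball q e' \<subseteq> \<Omega>"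
          using \<open>q \<in> \<Omega>\<close> open_domain open_contains_ball by blast
        define s where "s = min e e' / 2"
        have s: "s > 0" "s < e" "s < e'" using that e'(1) by (auto simp: s_def min_def)
        \<comment> \<open>a point just outside \<open>T\<close>, beyond \<open>q\<close>\<close>
        let ?x = "q + s *\<^sub>R m"
        have d: "dist ?x q = s" using m(1) s by (simp add: dist_norm)
        then have "?x \<in> closure \<Omega>" using e' s closure_subset by (metis dist_commute mem_ball subsetD)
        moreover have "m \<bullet> ?x > d" using mq m(1) s by (simp add: inner_add_right norm_eq_1)
        ultimately have "?x \<in> \<Union>\<T>" "?x \<notin> T"
          using Tsub[of ?x] Union_mesh by auto
        then have "?x \<in> R" unfolding R_def by blast
        then show ?thesis using d s by (metis)
      qed
      then have "q \<in> R" using \<open>closed R\<close> closed_approachable by blast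
      then obtain T' where T': "T' \<in> \<T>" "T' \<noteq> T" "q \<in> T'" by (auto simp: R_def)
      have "F face_of T'" by (rule face_of_if_meets[OF T(1) T'(1) F(1) q T'(3)])
      moreover have "F \<noteq> {}" using T(2) by (auto simp: facet_of_def)
      ultimately have "F facet_of T'"
        using aff_dim_mesh_face[OF T] aff_dim_mesh[OF T'(1)] by (simp add: facet_of_def)
      then show False using only[OF T'(1)] T'(2) by simp
    qed
    moreover have "q \<in> closure \<Omega>" unfolding Union_mesh[symmetric] using qT T(1) by (rule UnionI[rotated])
    ultimately show "q \<in> frontier \<Omega>" by (simp add: frontier_def interior_open open_domain)
  qed
  then have "closure (rel_interior F) \<subseteq> frontier \<Omega>" by (simp add: closure_minimal)
  then show ?thesis using convex_closure_rel_interior[OF F(2)] closure_subset by blast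
qed

end

section \<open>Face split points\<close>

context wf_mesh
begin

abbreviation split :: "point set \<Rightarrow> point" where
  "split F \<equiv> face_split_point \<Omega> \<T> F"

lemma facet_face_of: "F facet_of T \<Longrightarrow> F face_of T"
  by (simp add: facet_of_def)

lemma rel_interior_facet_nonempty:
  assumes "F facet_of T"
  shows "rel_interior F \<noteq> {}"
proof -
  have "convex F" "F \<noteq> {}" using assms face_of_imp_convex by (auto simp: facet_of_def)
  then show ?thesis using rel_interior_eq_empty by blast
qed

lemma card_verts_facet:
  assumes "T \<in> \<T>" "F facet_of T"
  shows "card (verts F) = 3" "\<not> affine_dependent (verts F)" "F = convex hull (verts F)"
proof -
  obtain C w where C: "\<not> affine_dependent C" "card C = 4" "T = convex hull C" "verts T = C"
    "w \<in> C" "F = convex hull (C - {w})" "verts F = C - {w}" "\<not> affine_dependent (C - {w})"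
    by (rule tetrahedron_facet_verts[OF simplex_mesh[OF assms(1)] assms(2)])
  show "card (verts F) = 3" "\<not> affine_dependent (verts F)" "F = convex hull (verts F)"
    using C by simp_all
qed

lemma shared_face_not_boundary:
  assumes T: "T1 \<in> \<T>" "T2 \<in> \<T>" "T1 \<noteq> T2" and F: "F facet_of T1" "F facet_of T2"
  shows "\<not> F \<subseteq> frontier \<Omega>"
proof -
  obtain z where z: "z \<in> rel_interior F" using rel_interior_facet_nonempty[OF F(1)] by blast
  then have "z \<in> \<Omega>" using shared_face(1)[OF T F] by blast
  then have "z \<notin> frontier \<Omega>" using open_domain by (simp add: frontier_def interior_open)
  then show ?thesis using z rel_interior_subset by blast
qed

lemma boundary_face_unique:
  assumes "F \<subseteq> frontier \<Omega>" "T \<in> \<T>" "F facet_of T" "T' \<in> \<T>" "F facet_of T'"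
  shows "T' = T"
  using shared_face_not_boundary assms by blast

lemma interior_face_shared:
  assumes "\<not> F \<subseteq> frontier \<Omega>" "T \<in> \<T>" "F facet_of T"
  obtains T' where "T' \<in> \<T>" "T' \<noteq> T" "F facet_of T'"
  using unshared_face assms by blast

lemma split_shared_face:
  assumes T: "T1 \<in> \<T>" "T2 \<in> \<T>" "T1 \<noteq> T2" and F: "F facet_of T1" "F facet_of T2"
  shows "split F \<in> rel_interior F" "split F \<in> open_segment (incenter T1) (incenter T2)"
proof -
  obtain z where z: "z \<in> rel_interior F" "z \<in> open_segment (incenter T1) (incenter T2)"
      "closed_segment (incenter T1) (incenter T2) \<inter> F = {z}"
    using shared_face(2)[OF T F] by blast
  have "split F = (THE z. \<exists>T\<^sub>1\<in>\<T>. \<exists>T\<^sub>2\<in>\<T>. T\<^sub>1 \<noteq> T\<^sub>2 \<and> F facet_of T\<^sub>1 \<and> F facet_of T\<^sub>2 \<and>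
              z \<in> closed_segment (incenter T\<^sub>1) (incenter T\<^sub>2) \<inter> F)"
    using shared_face_not_boundary[OF T F] by (simp add: face_split_point_def)
  also have "\<dots> = z"
  proof (rule the_equality)
    show "\<exists>T\<^sub>1\<in>\<T>. \<exists>T\<^sub>2\<in>\<T>. T\<^sub>1 \<noteq> T\<^sub>2 \<and> F facet_of T\<^sub>1 \<and> F facet_of T\<^sub>2 \<and>
              z \<in> closed_segment (incenter T\<^sub>1) (incenter T\<^sub>2) \<inter> F"
      using T F z(3) by blast
    fix y assume "\<exists>T\<^sub>1\<in>\<T>. \<exists>T\<^sub>2\<in>\<T>. T\<^sub>1 \<noteq> T\<^sub>2 \<and> F facet_of T\<^sub>1 \<and> F facet_of T\<^sub>2 \<and>
              y \<in> closed_segment (incenter T\<^sub>1) (incenter T\<^sub>2) \<inter> F"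
    then obtain S1 S2 where S: "S1 \<in> \<T>" "S2 \<in> \<T>" "S1 \<noteq> S2" "F facet_of S1" "F facet_of S2"
      "y \<in> closed_segment (incenter S1) (incenter S2) \<inter> F" by blast
    have "S1 = T1 \<or> S1 = T2" "S2 = T1 \<or> S2 = T2" using shared_face(3)[OF T F] S by blast+
    then have "y \<in> closed_segment (incenter T1) (incenter T2) \<inter> F"
      using S(3,6) by (auto simp: closed_segment_commute)
    then show "y = z" using z(3) by simp
  qed
  finally show "split F \<in> rel_interior F" "split F \<in> open_segment (incenter T1) (incenter T2)"
    using z by simp_all
qed

lemma split_rel_interior:
  assumes T: "T \<in> \<T>" "F facet_of T"
  shows "split F \<in> rel_interior F"
proof (cases "F \<subseteq> frontier \<Omega>")
  case True
  note V = card_verts_facet[OF T]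
  have "finite (verts F)" using V(1) by (simp add: card_ge_0_finite)
  have "split F = (1/3) *\<^sub>R (\<Sum>v\<in>verts F. v)"
    using True by (simp add: face_split_point_def face_barycenter_def verts_def)
  then have "split F = (\<Sum>v\<in>verts F. (1/3) *\<^sub>R v)" by (simp add: scaleR_sum_right)
  then have "split F \<in> rel_interior (convex hull (verts F))"
    unfolding rel_interior_convex_hull_explicit[OF V(2)]
    using V(1) by (intro CollectI exI[of _ "\<lambda>_. 1/3"]) simp
  then show ?thesis using V(3) by simp
next
  case False
  then obtain T' where "T' \<in> \<T>" "T' \<noteq> T" "F facet_of T'"
    using interior_face_shared T by blast
  then show ?thesis using split_shared_face(1)[of T T' F] T by blast
qed

lemma split_mem_facet: "T \<in> \<T> \<Longrightarrow> F facet_of T \<Longrightarrow> split F \<in> F"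
  using split_rel_interior rel_interior_subset by blast

lemma incenter_rel_interior: "T \<in> \<T> \<Longrightarrow> incenter T \<in> rel_interior T"
  using incenter_interior simplex_mesh rel_interior_mesh by blast

lemma face_of_self: "T \<in> \<T> \<Longrightarrow> T face_of T"
  using convex_mesh face_of_refl by blast

lemma vertex_face_of:
  assumes "F facet_of T" "v \<in> verts F"
  shows "{v} face_of T"
proof -
  have "{v} face_of F" using assms(2) by (simp add: verts_def face_of_singleton)
  then show ?thesis using face_of_trans facet_face_of[OF assms(1)] by blast
qed

lemma split_inj:
  assumes "T \<in> \<T>" "T' \<in> \<T>" "F facet_of T" "F' facet_of T'" "split F = split F'"
  shows "F = F'"
  using face_eqI[of T T' F F' "split F"] split_rel_interior[of T F] split_rel_interior[of T' F']
    assms facet_face_of by metis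

lemma incenter_neq_split:
  assumes "T \<in> \<T>" "T' \<in> \<T>" "F facet_of T'"
  shows "incenter T \<noteq> split F"
proof
  assume "incenter T = split F"
  then have "T = F"
    using face_eqI[of T T' T F "incenter T"] incenter_rel_interior[of T] split_rel_interior[of T' F]
      assms facet_face_of[of F T'] face_of_self[of T] by simp
  then show False using aff_dim_mesh aff_dim_mesh_face assms by fastforce
qed

lemma incenter_neq_vert:
  assumes "T \<in> \<T>" "T' \<in> \<T>" "F facet_of T'" "v \<in> verts F"
  shows "incenter T \<noteq> v"
proof
  assume "incenter T = v"
  then have "T = {v}"
    using face_eqI[of T T' T "{v}" "incenter T"] incenter_rel_interior[of T]
      assms vertex_face_of[of F T' v] face_of_self[of T] by simp
  then show False using aff_dim_mesh[of T] assms by simp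
qed

lemma split_neq_vert:
  assumes "T \<in> \<T>" "F facet_of T" "T' \<in> \<T>" "F' facet_of T'" "v \<in> verts F'"
  shows "split F \<noteq> v"
proof
  assume "split F = v"
  then have "F = {v}"
    using face_eqI[of T T' F "{v}" "split F"] split_rel_interior[of T F]
      assms vertex_face_of[of F' T' v] facet_face_of[of F T] by simp
  then show False using aff_dim_mesh_face[of T F] assms by simp
qed

section \<open>Cells of the refinement\<close>

text \<open>The cells are indexed by flags: a tetrahedron \<open>T\<close>, a facet \<open>F\<close> of it, and a vertex \<open>u\<close> of
  \<open>F\<close>, which stands for the opposite edge of \<open>F\<close>.\<close>

definition flag :: "point set \<Rightarrow> point set \<Rightarrow> point \<Rightarrow> bool" where
  "flag T F u \<longleftrightarrow> T \<in> \<T> \<and> F facet_of T \<and> u \<in> verts F"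

text \<open>The vertices of the cell of a flag, and the cell itself.\<close>

definition cell_verts :: "point set \<Rightarrow> point set \<Rightarrow> point \<Rightarrow> point set" where
  "cell_verts T F u = insert (incenter T) (insert (split F) (verts F - {u}))"

definition cell :: "point set \<Rightarrow> point set \<Rightarrow> point \<Rightarrow> point set" where
  "cell T F u = convex hull (cell_verts T F u)"

lemma flag_frame:
  assumes "flag T F u"
  obtains C w n b r where "framed_simplex C n b" "T = convex hull C" "w \<in> C"
    "F = convex hull (C - {w})" "verts F = C - {w}" "verts T = C" "u \<in> C - {w}" "r > 0"
    "\<forall>a\<in>C. framed_simplex.height n b a (incenter T) = r"
    "cell_verts T F u = insert (incenter T) (insert (split F) (C - {w, u}))"
proof -
  have T: "T \<in> \<T>" "F facet_of T" "u \<in> verts F" using assms by (auto simp: flag_def)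
  obtain C w where C: "\<not> affine_dependent C" "card C = 4" "T = convex hull C" "verts T = C"
    "w \<in> C" "F = convex hull (C - {w})" "verts F = C - {w}" "\<not> affine_dependent (C - {w})"
    by (rule tetrahedron_facet_verts[OF simplex_mesh[OF T(1)] T(2)])
  obtain n b where fs: "framed_simplex C n b"
    using framed_simplex_exists[of C] C by auto
  obtain r where r: "r > 0" "\<forall>a\<in>C. framed_simplex.height n b a (incenter T) = r"
    using incenter_framed[OF fs] C(3) by blast
  have "cell_verts T F u = insert (incenter T) (insert (split F) (C - {w, u}))"
    using C(7) by (auto simp: cell_verts_def)
  then show ?thesis using that[OF fs C(3,5,6,7,4) _ r] T(3) C(7) by simp
qed

lemma cell_indep:
  assumes f: "flag T F u"
  shows "\<not> affine_dependent (cell_verts T F u)" "incenter T \<notin> affine hull F"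
proof -
  have T: "T \<in> \<T>" "F facet_of T" using f by (auto simp: flag_def)
  obtain C w n b r where C: "framed_simplex C n b" "T = convex hull C" "w \<in> C"
    "F = convex hull (C - {w})" "verts F = C - {w}" "verts T = C" "u \<in> C - {w}" "r > 0"
    "\<forall>a\<in>C. framed_simplex.height n b a (incenter T) = r"
    "cell_verts T F u = insert (incenter T) (insert (split F) (C - {w, u}))"
    by (rule flag_frame[OF f])
  interpret framed_simplex C n b by fact
  note * = aff_independent_split[OF C(3,7), of "incenter T" "split F"]
  have "incenter T \<in> interior (convex hull C)" "split F \<in> rel_interior (convex hull (C - {w}))"
    using incenter_interior[OF simplex_mesh[OF T(1)]] split_rel_interior[OF T] C(2,4) by simp_all
  then show "\<not> affine_dependent (cell_verts T F u)" "incenter T \<notin> affine hull F"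
    using * C(10) C(4) by simp_all
qed

lemma verts_cell: "flag T F u \<Longrightarrow> verts (cell T F u) = cell_verts T F u"
  using cell_indep(1) verts_simplex by (simp add: cell_def)

lemma card_cell_verts:
  assumes f: "flag T F u"
  shows "card (cell_verts T F u) = 4"
proof -
  have T: "T \<in> \<T>" "F facet_of T" "u \<in> verts F" using f by (auto simp: flag_def)
  have "finite (verts F)" using card_verts_facet[OF T(1,2)] by (simp add: card_ge_0_finite)
  moreover have "card (verts F - {u}) = 2" using card_verts_facet[OF T(1,2)] T(3) by simp
  moreover have "split F \<notin> verts F - {u}" using split_neq_vert[OF T(1,2) T(1,2)] by blast
  moreover have "incenter T \<notin> insert (split F) (verts F - {u})"
    using incenter_neq_split[OF T(1) T(1,2)] incenter_neq_vert[OF T(1) T(1,2)] by blast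
  ultimately show ?thesis by (simp add: cell_verts_def)
qed

lemma interior_cell_nonempty:
  assumes f: "flag T F u"
  shows "interior (cell T F u) \<noteq> {}"
proof -
  let ?W = "cell_verts T F u"
  have "(\<Sum>x\<in>?W. (1/4) *\<^sub>R x) \<in> interior (cell T F u)"
    unfolding cell_def interior_convex_hull_explicit_minimal[OF cell_indep(1)[OF f]]
    using card_cell_verts[OF f] by (auto intro!: exI[of _ "\<lambda>_. 1/4"])
  then show ?thesis by blast
qed

lemma cell_subset:
  assumes f: "flag T F u"
  shows "cell T F u \<subseteq> T"
proof -
  have T: "T \<in> \<T>" "F facet_of T" using f by (auto simp: flag_def)
  have FT: "F \<subseteq> T" using T(2) facet_of_imp_subset by blast
  have "cell_verts T F u \<subseteq> T"
    using incenter_interior[OF simplex_mesh[OF T(1)]] interior_subset split_mem_facet[OF T] FT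
    by (auto simp: cell_verts_def verts_def extreme_point_of_def)
  then show ?thesis unfolding cell_def by (rule hull_minimal) (rule convex_mesh[OF T(1)])
qed

text \<open>Distinct cells have disjoint interiors.\<close>

lemma cell_eqI:
  assumes f: "flag T F u" "flag T' F' u'"
    and x: "x \<in> interior (cell T F u)" "x \<in> interior (cell T' F' u')"
  shows "T = T' \<and> F = F' \<and> u = u'"
proof -
  have T: "T \<in> \<T>" "F facet_of T" and T': "T' \<in> \<T>" "F' facet_of T'" using f by (auto simp: flag_def)
  have "x \<in> interior T" "x \<in> interior T'"
    using x interior_mono[OF cell_subset[OF f(1)]] interior_mono[OF cell_subset[OF f(2)]] by blast+
  then have TT: "T = T'" using mesh_eqI[OF T(1) T'(1)] interior_subset by blast
  obtain C w n b r where C: "framed_simplex C n b" "T = convex hull C" "w \<in> C"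
    "F = convex hull (C - {w})" "verts F = C - {w}" "verts T = C" "u \<in> C - {w}" "r > 0"
    "\<forall>a\<in>C. framed_simplex.height n b a (incenter T) = r"
    "cell_verts T F u = insert (incenter T) (insert (split F) (C - {w, u}))"
    by (rule flag_frame[OF f(1)])
  obtain C' w' n' b' r' where C': "framed_simplex C' n' b'" "T' = convex hull C'" "w' \<in> C'"
    "F' = convex hull (C' - {w'})" "verts F' = C' - {w'}" "verts T' = C'" "u' \<in> C' - {w'}" "r' > 0"
    "\<forall>a\<in>C'. framed_simplex.height n' b' a (incenter T') = r'"
    "cell_verts T' F' u' = insert (incenter T') (insert (split F') (C' - {w', u'}))"
    by (rule flag_frame[OF f(2)])
  have CC: "C' = C" using C(6) C'(6) TT by simp
  note C'' = C'[unfolded CC TT[symmetric]]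
  interpret framed_simplex C n b by fact
  have z: "split F \<in> rel_interior (convex hull (C - {w}))" using split_rel_interior[OF T] C(4) by simp
  have z': "split F' \<in> rel_interior (convex hull (C - {w'}))"
    using split_rel_interior[OF T'] C''(4) by simp
  note h = split_cell_heights[OF C(3) C(7) C(9) C(8) z x(1)[unfolded cell_def C(10)]]
  note h' = split_cell_heights[OF C''(3) C''(7) C(9) C(8) z' x(2)[unfolded cell_def TT[symmetric], unfolded C''(10)]]
  have "w = w'"
  proof (rule ccontr)
    assume "w \<noteq> w'"
    then have "height w x < height w' x" "height w' x < height w x"
      using h(1) h'(1) C(3) C''(3) by auto
    then show False by simp
  qed
  then have FF: "F = F'" using C(4) C''(4) by simp
  have "u = u'"
  proof (rule ccontr)
    assume ne: "u \<noteq> u'"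
    let ?\<rho> = "\<lambda>a. (height a x - height w x) / height a (split F)"
    have "?\<rho> u < ?\<rho> u'" using h(2) C''(7) ne \<open>w = w'\<close> by auto
    moreover have "?\<rho> u' < ?\<rho> u" using h'(2) C(7) ne \<open>w = w'\<close> FF by auto
    ultimately show False by simp
  qed
  then show ?thesis using TT FF by simp
qed

lemma split_mem_cell_verts:
  assumes f: "flag T F u" and T': "T' \<in> \<T>" "F' facet_of T'" and "split F' \<in> cell_verts T F u"
  shows "F' = F"
proof -
  have T: "T \<in> \<T>" "F facet_of T" "u \<in> verts F" using f by (auto simp: flag_def)
  have "split F' \<notin> verts F" using split_neq_vert[OF T' T(1,2)] by blast
  then have "split F' = split F"
    using assms(4) incenter_neq_split[OF T(1) T'] by (auto simp: cell_verts_def)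
  then show ?thesis using split_inj T T' by blast
qed

lemma vert_mem_cell_verts:
  assumes f: "flag T F u" and T': "T' \<in> \<T>" "F' facet_of T'" "v \<in> verts F'" and "v \<in> cell_verts T F u"
  shows "v \<in> verts F - {u}"
proof -
  have T: "T \<in> \<T>" "F facet_of T" "u \<in> verts F" using f by (auto simp: flag_def)
  show ?thesis
    using assms(5) incenter_neq_vert[OF T(1) T'] split_neq_vert[OF T(1,2) T'] by (auto simp: cell_verts_def)
qed

lemma cell_inject:
  assumes "flag T F u" "flag T' F' u'" "cell T F u = cell T' F' u'"
  shows "T = T' \<and> F = F' \<and> u = u'"
  using interior_cell_nonempty[OF assms(1)] cell_eqI[OF assms(1,2)] assms(3) by auto

lemma WF_eq: "WF \<Omega> \<T> = {cell T F u |T F u. flag T F u}"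
proof -
  have "e edge_of F \<longleftrightarrow> (\<exists>u\<in>verts F. e = convex hull (verts F - {u}))"
    if "T \<in> \<T>" "F facet_of T" for T F e
  proof -
    note V = card_verts_facet[OF that]
    have "e edge_of F \<longleftrightarrow> e facet_of F"
      using aff_dim_mesh_face[OF that] by (auto simp: edge_of_def facet_of_def)
    then show ?thesis
      using facet_of_convex_hull_affine_independent_alt[OF V(2), of e] V(1) V(3) by (simp add: Bex_def)
  qed
  moreover have "convex hull ({incenter T, split F} \<union> convex hull (verts F - {u})) = cell T F u" for T F u
    by (simp add: cell_def cell_verts_def hull_Un_right[symmetric] del: Un_insert_left)
       (simp add: insert_commute)
  ultimately show ?thesis
    unfolding WF_def flag_def by (auto; metis)
qed

lemma cell_facet_iff:
  assumes "flag T F u"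
  shows "G facet_of cell T F u \<longleftrightarrow>
    (\<exists>y\<in>cell_verts T F u. G = convex hull (cell_verts T F u - {y}))"
  using facet_of_convex_hull_affine_independent_alt[OF cell_indep(1)[OF assms]]
    card_cell_verts[OF assms] by (auto simp: cell_def)

lemma cell_edge_iff:
  assumes "flag T F u"
  shows "e edge_of cell T F u \<longleftrightarrow>
    (\<exists>p q. p \<in> cell_verts T F u \<and> q \<in> cell_verts T F u \<and> p \<noteq> q \<and> e = convex hull {p, q})"
  using edge_of_simplex_iff[OF cell_indep(1)[OF assms]] by (simp add: cell_def)

lemma cell_facet_across:
  assumes f: "flag T F u" and T': "T' \<in> \<T>" "T \<noteq> T'" and G: "G facet_of cell T F u" "G \<subseteq> T'"
  shows "verts G = insert (split F) (verts F - {u})"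
proof -
  have T: "T \<in> \<T>" "F facet_of T" "u \<in> verts F" using f by (auto simp: flag_def)
  obtain y where y: "y \<in> cell_verts T F u" "G = convex hull (cell_verts T F u - {y})"
    using G(1) cell_facet_iff[OF f] by blast
  have "incenter T \<notin> T'"
    using mesh_eqI[OF T(1) T'(1)] incenter_interior[OF simplex_mesh[OF T(1)]] T'(2) by blast
  then have "incenter T \<notin> cell_verts T F u - {y}"
    using y(2) G(2) hull_inc[of "incenter T" "cell_verts T F u - {y}" convex] by blast
  then have "y = incenter T" by (simp add: cell_verts_def)
  moreover have "\<not> affine_dependent (cell_verts T F u - {y})"
    using cell_indep(1)[OF f] affine_independent_Diff by blast
  ultimately have "verts G = cell_verts T F u - {incenter T}" using verts_simplex y by simp
  moreover have "incenter T \<notin> insert (split F) (verts F - {u})"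
    using incenter_neq_split[OF T(1) T(1,2)] incenter_neq_vert[OF T(1) T(1,2)] by blast
  ultimately show ?thesis by (simp add: cell_verts_def)
qed

text \<open>Two cells in different tetrahedra that share a facet lie at the same mesh face and omit the
  same vertex: by \<open>cell_facet_across\<close> the shared facet is spanned by the split point and the
  remaining vertices, and these determine the face and the omitted vertex.\<close>

lemma share_face_across:
  assumes f: "flag T F u" "flag T' F' u'" and "T \<noteq> T'" and s: "share_face (cell T F u) (cell T' F' u')"
  shows "F = F' \<and> u = u'"
proof -
  have T: "T \<in> \<T>" "F facet_of T" "u \<in> verts F" and T': "T' \<in> \<T>" "F' facet_of T'" "u' \<in> verts F'"
    using f by (auto simp: flag_def)
  obtain G where G: "G facet_of cell T F u" "G facet_of cell T' F' u'"
    using s by (auto simp: share_face_def)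
  have "G \<subseteq> T" "G \<subseteq> T'" using G facet_of_imp_subset cell_subset f by blast+
  then have eq: "insert (split F) (verts F - {u}) = insert (split F') (verts F' - {u'})"
    using cell_facet_across[OF f(1) T'(1) assms(3) G(1)]
      cell_facet_across[OF f(2) T(1) assms(3)[symmetric] G(2)] by simp
  then have "split F \<in> cell_verts T' F' u'" by (auto simp: cell_verts_def)
  then have FF: "F = F'" using split_mem_cell_verts[OF f(2) T(1,2)] by blast
  have "split F \<notin> verts F" using split_neq_vert[OF T(1,2) T(1,2)] by blast
  then have "verts F - {u} = verts F - {u'}" using eq unfolding FF[symmetric] by (metis Diff_iff insert_ident)
  then show ?thesis using FF T(3) T'(3) by blast
qed

end

section \<open>Singular edges\<close>

lemma affine_hull_triples_distinct:
  fixes D :: "point set"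
  assumes D: "\<not> affine_dependent D" and "p \<in> D" "q \<in> D" "s \<in> D" "t \<in> D" "t \<noteq> p" "t \<noteq> q" "t \<noteq> s"
  shows "affine hull {p, q, s} \<noteq> affine hull {p, q, t}"
proof
  assume eq: "affine hull {p, q, s} = affine hull {p, q, t}"
  have "t \<in> affine hull {p, q, t}" by (simp add: hull_inc)
  also have "\<dots> \<subseteq> affine hull (D - {t})" unfolding eq[symmetric] by (rule hull_mono) (use assms in auto)
  finally show False using D assms(5) by (auto simp: affine_dependent_def)
qed

lemma card_neq_2I: "A \<in> S \<Longrightarrow> B \<in> S \<Longrightarrow> C \<in> S \<Longrightarrow> A \<noteq> B \<Longrightarrow> A \<noteq> C \<Longrightarrow> B \<noteq> C \<Longrightarrow> card S \<noteq> 2"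
  by (auto simp: card_2_iff)

lemma share_face_sym: "share_face A B \<Longrightarrow> share_face B A"
  by (auto simp: share_face_def)

context wf_mesh
begin

text \<open>The planes of the faces of the refinement that meet at the edge \<open>e\<close>.\<close>

definition face_planes :: "point set \<Rightarrow> point set set" where
  "face_planes e = {affine hull G |G. G \<in> mesh_faces (WF \<Omega> \<T>) \<and> e edge_of G}"

lemma singular_edges_iff:
  "e \<in> singular_edges (WF \<Omega> \<T>) \<longleftrightarrow> e \<in> mesh_edges (WF \<Omega> \<T>) \<and> card (face_planes e) = 2"
  by (simp add: singular_edges_def face_planes_def)

lemma cell_in_WF: "flag T F u \<Longrightarrow> cell T F u \<in> WF \<Omega> \<T>"
  by (auto simp: WF_eq)

lemma verts_facet_cases:
  assumes "T \<in> \<T>" "F facet_of T" "a \<in> verts F"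
  obtains b d where "verts F = {a, b, d}" "a \<noteq> b" "a \<noteq> d" "b \<noteq> d"
proof -
  have "card (verts F - {a}) = 2" using card_verts_facet(1)[OF assms(1,2)] assms(3) by simp
  then obtain b d where "verts F - {a} = {b, d}" "b \<noteq> d" by (auto simp: card_2_iff)
  then show ?thesis using that[of b d] assms(3) by blast
qed

lemma face_planesI:
  assumes f: "flag T F u" and W: "cell_verts T F u = {p, q, s, t}"
    and ne: "p \<noteq> q" "p \<noteq> s" "q \<noteq> s" "t \<noteq> p" "t \<noteq> q" "t \<noteq> s"
  shows "affine hull {p, q, s} \<in> face_planes (convex hull {p, q})"
proof -
  let ?G = "convex hull {p, q, s}"
  have "cell_verts T F u - {t} = {p, q, s}" using W ne by auto
  then have "?G facet_of cell T F u" using cell_facet_iff[OF f] W by (metis insertCI)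
  moreover have "\<not> affine_dependent {p, q, s}"
    using cell_indep(1)[OF f] W affine_dependent_subset by (metis insert_mono subset_insertI)
  then have "convex hull {p, q} edge_of ?G" using edge_of_simplex_iff ne by auto
  ultimately show ?thesis
    using cell_in_WF[OF f] unfolding face_planes_def mesh_faces_def
    by (intro CollectI exI[of _ ?G]) auto
qed

text \<open>The three kinds of non-singular edges of a cell at the facet \<open>F\<close> with vertices \<open>a\<close>, \<open>b\<close>, \<open>d\<close>,
  namely incenter to split point, incenter to vertex, and vertex to vertex: each lies on three
  different face planes.\<close>

context
  fixes T F a b d
  assumes T: "T \<in> \<T>" and F: "F facet_of T"
    and vF: "verts F = {a, b, d}" and ne: "a \<noteq> b" "a \<noteq> d" "b \<noteq> d"
begin

lemma flags: "flag T F a" "flag T F b" "flag T F d"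
  using T F vF by (simp_all add: flag_def)

lemma cell_verts_abd:
  "cell_verts T F d = {incenter T, split F, a, b}"
  "cell_verts T F b = {incenter T, split F, a, d}"
  "cell_verts T F a = {incenter T, split F, b, d}"
  using vF ne by (auto simp: cell_verts_def)

lemma points_distinct:
  "incenter T \<noteq> split F" "incenter T \<noteq> a" "incenter T \<noteq> b" "incenter T \<noteq> d"
  "split F \<noteq> a" "split F \<noteq> b" "split F \<noteq> d"
  using incenter_neq_split[OF T T F] incenter_neq_vert[OF T T F] split_neq_vert[OF T F T F] vF by auto

lemma nonsingular_incenter_split: "card (face_planes (convex hull {incenter T, split F})) \<noteq> 2"
proof (rule card_neq_2I)
  let ?c = "incenter T" and ?z = "split F"
  note pd = points_distinct points_distinct[symmetric] ne ne[symmetric]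
  show "affine hull {?c, ?z, a} \<in> face_planes (convex hull {?c, ?z})"
    by (rule face_planesI[OF flags(3), of _ _ _ b]) (use cell_verts_abd pd in auto)
  show "affine hull {?c, ?z, b} \<in> face_planes (convex hull {?c, ?z})"
    by (rule face_planesI[OF flags(3), of _ _ _ a]) (use cell_verts_abd pd in auto)
  show "affine hull {?c, ?z, d} \<in> face_planes (convex hull {?c, ?z})"
    by (rule face_planesI[OF flags(2), of _ _ _ a]) (use cell_verts_abd pd in auto)
  show "affine hull {?c, ?z, a} \<noteq> affine hull {?c, ?z, b}"
    by (rule affine_hull_triples_distinct[OF cell_indep(1)[OF flags(3)]]) (use cell_verts_abd pd in auto)
  show "affine hull {?c, ?z, a} \<noteq> affine hull {?c, ?z, d}"
    by (rule affine_hull_triples_distinct[OF cell_indep(1)[OF flags(2)]]) (use cell_verts_abd pd in auto)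
  show "affine hull {?c, ?z, b} \<noteq> affine hull {?c, ?z, d}"
    by (rule affine_hull_triples_distinct[OF cell_indep(1)[OF flags(1)]]) (use cell_verts_abd pd in auto)
qed

lemma incenter_verts_indep: "\<not> affine_dependent (insert (incenter T) (verts F))"
proof -
  have "incenter T \<notin> affine hull (verts F)"
    using cell_indep(2)[OF flags(1)] card_verts_facet(3)[OF T F] by (metis affine_hull_convex_hull)
  then show ?thesis using card_verts_facet(2)[OF T F] affine_independent_insert by blast
qed

lemma nonsingular_incenter_vert: "card (face_planes (convex hull {incenter T, a})) \<noteq> 2"
proof (rule card_neq_2I)
  let ?c = "incenter T" and ?z = "split F"
  note pd = points_distinct points_distinct[symmetric] ne ne[symmetric]
  show "affine hull {?c, a, ?z} \<in> face_planes (convex hull {?c, a})"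
    by (rule face_planesI[OF flags(3), of _ _ _ b]) (use cell_verts_abd pd in auto)
  show "affine hull {?c, a, b} \<in> face_planes (convex hull {?c, a})"
    by (rule face_planesI[OF flags(3), of _ _ _ ?z]) (use cell_verts_abd pd in auto)
  show "affine hull {?c, a, d} \<in> face_planes (convex hull {?c, a})"
    by (rule face_planesI[OF flags(2), of _ _ _ ?z]) (use cell_verts_abd pd in auto)
  show "affine hull {?c, a, ?z} \<noteq> affine hull {?c, a, b}"
    by (rule affine_hull_triples_distinct[OF cell_indep(1)[OF flags(3)]]) (use cell_verts_abd pd in auto)
  show "affine hull {?c, a, ?z} \<noteq> affine hull {?c, a, d}"
    by (rule affine_hull_triples_distinct[OF cell_indep(1)[OF flags(2)]]) (use cell_verts_abd pd in auto)
  show "affine hull {?c, a, b} \<noteq> affine hull {?c, a, d}"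
    by (rule affine_hull_triples_distinct[OF incenter_verts_indep]) (use vF pd in auto)
qed

lemma nonsingular_vert_vert: "card (face_planes (convex hull {a, b})) \<noteq> 2"
proof -
  let ?c = "incenter T" and ?z = "split F"
  note pd = points_distinct points_distinct[symmetric] ne ne[symmetric]
  obtain C w where C: "\<not> affine_dependent C" "card C = 4" "T = convex hull C" "verts T = C"
    "w \<in> C" "F = convex hull (C - {w})" "verts F = C - {w}" "\<not> affine_dependent (C - {w})"
    by (rule tetrahedron_facet_verts[OF simplex_mesh[OF T] F])
  have C_eq: "C = {a, b, d, w}" "w \<noteq> a" "w \<noteq> b" "w \<noteq> d" using C(5,7) vF by auto
  \<comment> \<open>the other facet of \<open>T\<close> containing the edge\<close>
  define F' where "F' = convex hull (C - {d})"
  have F': "F' facet_of T"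
    unfolding F'_def C(3) using facet_of_convex_hull_affine_independent_alt[OF C(1)] C(2) C_eq by auto
  have "\<not> affine_dependent (C - {d})" using C(1) affine_independent_Diff by blast
  then have vF': "verts F' = {a, b, w}"
    unfolding F'_def using verts_simplex C_eq ne by auto
  let ?z' = "split F'"
  have f': "flag T F' w" using T F' vF' by (simp add: flag_def)
  have W': "cell_verts T F' w = {?c, ?z', a, b}" using vF' C_eq by (auto simp: cell_verts_def)
  have pd': "?c \<noteq> ?z'" "?z' \<noteq> a" "?z' \<noteq> b"
    using incenter_neq_split[OF T T F'] split_neq_vert[OF T F' T F'] vF' by auto
  show ?thesis
  proof (rule card_neq_2I)
    show "affine hull {a, b, ?z} \<in> face_planes (convex hull {a, b})"
      by (rule face_planesI[OF flags(3), of _ _ _ ?c]) (use cell_verts_abd pd in auto)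
    show "affine hull {a, b, ?c} \<in> face_planes (convex hull {a, b})"
      by (rule face_planesI[OF flags(3), of _ _ _ ?z]) (use cell_verts_abd pd in auto)
    show "affine hull {a, b, ?z'} \<in> face_planes (convex hull {a, b})"
      by (rule face_planesI[OF f', of _ _ _ ?c]) (use W' pd pd' in auto)
    show "affine hull {a, b, ?z} \<noteq> affine hull {a, b, ?c}"
      by (rule affine_hull_triples_distinct[OF cell_indep(1)[OF flags(3)]]) (use cell_verts_abd pd in auto)
    show "affine hull {a, b, ?c} \<noteq> affine hull {a, b, ?z'}"
      by (rule affine_hull_triples_distinct[OF cell_indep(1)[OF f']]) (use W' pd pd' in auto)
    show "affine hull {a, b, ?z} \<noteq> affine hull {a, b, ?z'}"
    proof
      assume eq: "affine hull {a, b, ?z} = affine hull {a, b, ?z'}"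
      have "?z \<in> F" "{a, b} \<subseteq> F"
        using split_mem_facet[OF T F] vF by (auto simp: verts_def extreme_point_of_def)
      then have "affine hull {a, b, ?z} \<subseteq> affine hull F" by (intro hull_mono) auto
      moreover have "?z' \<in> affine hull {a, b, ?z'}" by (simp add: hull_inc)
      ultimately have z1: "?z' \<in> affine hull (C - {w})" using eq C(6) by auto
      obtain n b where "framed_simplex C n b" using framed_simplex_exists[OF C(1)] C(2) by auto
      then interpret framed_simplex C n b .
      have "height w ?z' > 0"
        using split_rel_interior[OF T F'] mem_rel_interior_facet_iff[of d ?z'] C_eq F'_def by auto
      then show False using z1 plane[OF C(5)] by (simp add: height_def)
    qed
  qed
qed

end

lemma mem_affine_hull_open_segment:
  fixes c c' z :: "'a::euclidean_space"
  assumes "z \<in> open_segment c c'"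
  shows "c' \<in> affine hull {z, c}"
proof -
  obtain t where t: "0 < t" "z = (1 - t) *\<^sub>R c + t *\<^sub>R c'" using assms by (auto simp: in_segment)
  have "c' = (1 / t) *\<^sub>R z + (1 - 1 / t) *\<^sub>R c"
  proof -
    have "(1 / t) *\<^sub>R z = ((1 - t) / t) *\<^sub>R c + c'" using t by (simp add: scaleR_add_right)
    also have "(1 - t) / t = 1 / t - 1" using t(1) by (simp add: diff_divide_distrib)
    finally show ?thesis by (simp add: algebra_simps)
  qed
  then show ?thesis unfolding affine_hull_2 by force
qed

text \<open>The two planes at a split point edge: the plane of the mesh face, and the plane through the
  incenters, which are collinear with the split point.\<close>

lemma face_planes_split_vert:
  assumes T: "T \<in> \<T>" and F: "F facet_of T" and v: "v \<in> verts F"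
  shows "face_planes (convex hull {split F, v}) = {affine hull F, affine hull {split F, v, incenter T}}"
    and "affine hull F \<noteq> affine hull {split F, v, incenter T}"
proof -
  let ?c = "incenter T" and ?z = "split F"
  obtain b d where vF: "verts F = {v, b, d}" and ne: "v \<noteq> b" "v \<noteq> d" "b \<noteq> d"
    by (rule verts_facet_cases[OF T F v])
  note flags = flags[OF T F vF ne] and W = cell_verts_abd[OF T F vF ne] and pd = points_distinct[OF T F vF ne]
  note pd' = pd pd[symmetric] ne ne[symmetric]
  have plane: "affine hull {?z, v, x} = affine hull F" if x: "x = b \<or> x = d" for x
  proof -
    have "?z \<in> F" "{v, b, d} \<subseteq> F"
      using split_mem_facet[OF T F] vF by (auto simp: verts_def extreme_point_of_def)
    then have sub: "affine hull {?z, v, x} \<subseteq> affine hull F" using x by (intro hull_mono) auto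
    have "\<not> affine_dependent {?z, v, x}"
      using cell_indep(1)[OF flags(3)] cell_indep(1)[OF flags(2)] W x
      by (metis affine_dependent_subset subset_insertI)
    moreover have "card {?z, v, x} = 3" using pd' x by auto
    ultimately have "aff_dim {?z, v, x} = 2" using aff_dim_affine_independent by fastforce
    then show ?thesis
      using sub aff_dim_mesh_face[OF T F] by (intro affine_dim_equal) (auto simp: affine_affine_hull)
  qed
  have "?c \<in> affine hull {?z, v, ?c}" by (simp add: hull_inc)
  then show "affine hull F \<noteq> affine hull {?z, v, ?c}" using cell_indep(2)[OF flags(1)] by metis
  show "face_planes (convex hull {?z, v}) = {affine hull F, affine hull {?z, v, ?c}}"
  proof
    have "affine hull {?z, v, b} \<in> face_planes (convex hull {?z, v})"
      by (rule face_planesI[OF flags(3), of _ _ _ ?c]) (use W pd' in auto)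
    moreover have "affine hull {?z, v, ?c} \<in> face_planes (convex hull {?z, v})"
      by (rule face_planesI[OF flags(3), of _ _ _ b]) (use W pd' in auto)
    ultimately show "{affine hull F, affine hull {?z, v, ?c}} \<subseteq> face_planes (convex hull {?z, v})"
      using plane by auto
    show "face_planes (convex hull {?z, v}) \<subseteq> {affine hull F, affine hull {?z, v, ?c}}"
    proof
      fix P assume "P \<in> face_planes (convex hull {?z, v})"
      then obtain G T' F' u' where G: "P = affine hull G" "convex hull {?z, v} edge_of G"
        "flag T' F' u'" "G facet_of cell T' F' u'"
        unfolding face_planes_def mesh_faces_def WF_eq by blast
      obtain y where y: "y \<in> cell_verts T' F' u'" "G = convex hull (cell_verts T' F' u' - {y})"
        using G(4) cell_facet_iff[OF G(3)] by blast
      have indG: "\<not> affine_dependent (cell_verts T' F' u' - {y})"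
        using cell_indep(1)[OF G(3)] affine_independent_Diff by blast
      obtain p q where pq: "p \<in> cell_verts T' F' u' - {y}" "q \<in> cell_verts T' F' u' - {y}"
        "p \<noteq> q" "convex hull {?z, v} = convex hull {p, q}"
        using G(2) edge_of_simplex_iff[OF indG] y(2) by blast
      have "{?z, v} = {p, q}"
        using pq(4) verts_simplex[of "{?z, v}"] verts_simplex[of "{p, q}"] affine_independent_2 by metis
      then have zv: "?z \<in> cell_verts T' F' u'" "v \<in> cell_verts T' F' u'" "y \<noteq> ?z" "y \<noteq> v"
        using pq by auto
      have FF: "F' = F" using split_mem_cell_verts[OF G(3) T F zv(1)] by simp
      have T': "T' \<in> \<T>" "F facet_of T'" "u' \<in> verts F" using G(3) FF by (auto simp: flag_def)
      have "v \<noteq> u'" using vert_mem_cell_verts[OF G(3) T F v zv(2)] by blast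
      then have "cell_verts T' F' u' = {incenter T', ?z, v, b} \<or> cell_verts T' F' u' = {incenter T', ?z, v, d}"
        using T'(3) vF ne FF by (auto simp: cell_verts_def insert_Diff_if)
      then obtain x where x: "x = b \<or> x = d" "cell_verts T' F' u' = {incenter T', ?z, v, x}"
        by blast
      have pT': "incenter T' \<noteq> ?z" "incenter T' \<noteq> v" "incenter T' \<noteq> x"
        using incenter_neq_split[OF T'(1) T F] incenter_neq_vert[OF T'(1) T F] vF x(1) by auto
      have xx: "x \<noteq> ?z" "x \<noteq> v" using x(1) pd' by auto
      consider "y = incenter T'" | "y = x" using y(1) x(2) zv by auto
      then show "P \<in> {affine hull F, affine hull {?z, v, ?c}}"
      proof cases
        case 1
        then have "cell_verts T' F' u' - {y} = {?z, v, x}" using x(2) pT' by auto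
        then show ?thesis using G(1) y(2) plane[OF x(1)] by simp
      next
        case 2
        then have "cell_verts T' F' u' - {y} = {?z, v, incenter T'}" using x(2) pT' xx by auto
        then have P: "P = affine hull {?z, v, incenter T'}" using G(1) y(2) by simp
        have "P = affine hull {?z, v, ?c}"
        proof (cases "T' = T")
          case False
          have "?z \<in> open_segment ?c (incenter T')"
            using split_shared_face(2)[of T T' F] T F T' False by blast
          then have c': "incenter T' \<in> affine hull {?z, ?c}" and c: "?c \<in> affine hull {?z, incenter T'}"
            using mem_affine_hull_open_segment[of ?z ?c "incenter T'"]
              mem_affine_hull_open_segment[of ?z "incenter T'" ?c] open_segment_commute by auto
          have "{?z, v, incenter T'} \<subseteq> affine hull {?z, v, ?c}" "{?z, v, ?c} \<subseteq> affine hull {?z, v, incenter T'}"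
            using c' c hull_mono[of "{?z, ?c}" "{?z, v, ?c}" affine]
              hull_mono[of "{?z, incenter T'}" "{?z, v, incenter T'}" affine]
            by (auto simp: hull_inc)
          then show ?thesis unfolding P by (intro equalityI hull_minimal affine_affine_hull)
        qed (simp add: P)
        then show ?thesis by simp
      qed
    qed
  qed
qed

lemma singular_edges_WF:
  "singular_edges (WF \<Omega> \<T>) =
     {convex hull {split F, v} |T F v. T \<in> \<T> \<and> F facet_of T \<and> v \<in> verts F}"
proof
  show "singular_edges (WF \<Omega> \<T>) \<subseteq> {convex hull {split F, v} |T F v. T \<in> \<T> \<and> F facet_of T \<and> v \<in> verts F}"
  proof
    fix e assume e: "e \<in> singular_edges (WF \<Omega> \<T>)"
    then have "e \<in> mesh_edges (WF \<Omega> \<T>)" by (simp add: singular_edges_iff)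
    then obtain T F u where f: "flag T F u" "e edge_of cell T F u"
      by (auto simp: mesh_edges_def WF_eq)
    have card: "card (face_planes e) = 2" using e by (simp add: singular_edges_iff)
    have T: "T \<in> \<T>" "F facet_of T" "u \<in> verts F" using f by (auto simp: flag_def)
    obtain a b where vF0: "verts F = {u, a, b}" and ne0: "u \<noteq> a" "u \<noteq> b" "a \<noteq> b"
      by (rule verts_facet_cases[OF T])
    have vF: "verts F = {a, b, u}" "a \<noteq> b" "a \<noteq> u" "b \<noteq> u" and vF': "verts F = {b, a, u}" "b \<noteq> a" "b \<noteq> u" "a \<noteq> u"
      using vF0 ne0 by auto
    obtain p q where pq: "p \<in> cell_verts T F u" "q \<in> cell_verts T F u" "p \<noteq> q" "e = convex hull {p, q}"
      using f(2) cell_edge_iff[OF f(1)] by blast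
    have "\<not> ({p, q} = {incenter T, split F} \<or> {p, q} = {incenter T, a} \<or> {p, q} = {incenter T, b} \<or> {p, q} = {a, b})"
      using card pq(4) nonsingular_incenter_split[OF T(1,2) vF] nonsingular_incenter_vert[OF T(1,2) vF]
        nonsingular_incenter_vert[OF T(1,2) vF'] nonsingular_vert_vert[OF T(1,2) vF] by metis
    then have "{p, q} = {split F, a} \<or> {p, q} = {split F, b}"
      using pq(1-3) cell_verts_abd(1)[OF T(1,2) vF] by auto
    then have "e = convex hull {split F, a} \<or> e = convex hull {split F, b}" using pq(4) by auto
    then show "e \<in> {convex hull {split F, v} |T F v. T \<in> \<T> \<and> F facet_of T \<and> v \<in> verts F}"
      using T vF by blast
  qed
next
  show "{convex hull {split F, v} |T F v. T \<in> \<T> \<and> F facet_of T \<and> v \<in> verts F} \<subseteq> singular_edges (WF \<Omega> \<T>)"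
  proof clarify
    fix T F v assume T: "T \<in> \<T>" "F facet_of T" "v \<in> verts F"
    obtain b d where vF: "verts F = {v, b, d}" "v \<noteq> b" "v \<noteq> d" "b \<noteq> d"
      by (rule verts_facet_cases[OF T])
    have f: "flag T F b" using T(1,2) vF by (simp add: flag_def)
    have "convex hull {split F, v} edge_of cell T F b"
      using cell_edge_iff[OF f] cell_verts_abd(2)[OF T(1,2) vF] points_distinct(5)[OF T(1,2) vF] by auto
    then have "convex hull {split F, v} \<in> mesh_edges (WF \<Omega> \<T>)"
      using cell_in_WF[OF f] by (auto simp: mesh_edges_def)
    moreover have "card (face_planes (convex hull {split F, v})) = 2"
      using face_planes_split_vert[OF T] by simp
    ultimately show "convex hull {split F, v} \<in> singular_edges (WF \<Omega> \<T>)"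
      by (simp add: singular_edges_iff)
  qed
qed

lemma cells_at_split_vert:
  assumes T: "T \<in> \<T>" "F facet_of T" "v \<in> verts F"
  shows "{S \<in> WF \<Omega> \<T>. convex hull {split F, v} edge_of S} =
    {cell T' F u |T' u. T' \<in> \<T> \<and> F facet_of T' \<and> u \<in> verts F - {v}}"
proof (intro equalityI subsetI)
  fix S assume "S \<in> {S \<in> WF \<Omega> \<T>. convex hull {split F, v} edge_of S}"
  then obtain T' F' u where f: "flag T' F' u" "S = cell T' F' u" "convex hull {split F, v} edge_of cell T' F' u"
    by (auto simp: WF_eq)
  obtain p q where pq: "p \<in> cell_verts T' F' u" "q \<in> cell_verts T' F' u" "p \<noteq> q"
      "convex hull {split F, v} = convex hull {p, q}"
    using f(3) cell_edge_iff[OF f(1)] by blast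
  have "{split F, v} = {p, q}"
    using pq(4) verts_simplex[of "{split F, v}"] verts_simplex[of "{p, q}"] affine_independent_2 by metis
  then have zv: "split F \<in> cell_verts T' F' u" "v \<in> cell_verts T' F' u" using pq by auto
  have "F = F'" using split_mem_cell_verts[OF f(1) T(1,2) zv(1)] .
  moreover have "v \<noteq> u" using vert_mem_cell_verts[OF f(1) T zv(2)] by blast
  ultimately show "S \<in> {cell T' F u |T' u. T' \<in> \<T> \<and> F facet_of T' \<and> u \<in> verts F - {v}}"
    using f by (auto simp: flag_def)
next
  fix S assume "S \<in> {cell T' F u |T' u. T' \<in> \<T> \<and> F facet_of T' \<and> u \<in> verts F - {v}}"
  then obtain T' u where S: "S = cell T' F u" "T' \<in> \<T>" "F facet_of T'" "u \<in> verts F" "u \<noteq> v" by blast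
  have f: "flag T' F u" using S by (simp add: flag_def)
  have "v \<in> cell_verts T' F u" "split F \<in> cell_verts T' F u" using S T(3) by (auto simp: cell_verts_def)
  moreover have "split F \<noteq> v" using split_neq_vert[OF T(1,2) T] .
  ultimately have "convex hull {split F, v} edge_of S" using cell_edge_iff[OF f] S(1) by blast
  then show "S \<in> {S \<in> WF \<Omega> \<T>. convex hull {split F, v} edge_of S}"
    using cell_in_WF[OF f] S(1) by blast
qed

end

section \<open>The functionals at singular edges\<close>

text \<open>Four cells listed so that consecutive ones share a face: if \<open>A1\<close>, \<open>B2\<close> and \<open>B1\<close>, \<open>A2\<close> do
  not share a face, these pairs occupy the positions of equal parity.\<close>

lemma alternating_sum_cycle:
  fixes f :: "'b \<Rightarrow> real" and l :: "nat \<Rightarrow> 'b"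
  assumes bij: "bij_betw l {1..4} {A1, B1, A2, B2}" and card: "card {A1, B1, A2, B2} = 4"
    and adj: "\<forall>j\<in>{1..<4}. R (l j) (l (j + 1))"
    and sym: "\<And>X Y. R X Y \<Longrightarrow> R Y X" and na: "\<not> R A1 B2" "\<not> R B1 A2"
  shows "f (l 1) - f (l 2) + f (l 3) - f (l 4) = 0 \<longleftrightarrow> f A1 - f A2 = f B1 - f B2"
proof -
  have set: "{1..4::nat} = {1, 2, 3, 4}" by auto
  have inj: "l 1 \<noteq> l 2" "l 1 \<noteq> l 3" "l 1 \<noteq> l 4" "l 2 \<noteq> l 3" "l 2 \<noteq> l 4" "l 3 \<noteq> l 4"
  proof -
    have "inj_on l {1, 2, 3, 4}" using bij unfolding bij_betw_def set by blast
    then show "l 1 \<noteq> l 2" "l 1 \<noteq> l 3" "l 1 \<noteq> l 4" "l 2 \<noteq> l 3" "l 2 \<noteq> l 4" "l 3 \<noteq> l 4"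
      by (simp_all add: inj_on_eq_iff)
  qed
  have "{1..<4::nat} = {1, 2, 3}" by auto
  then have R: "R (l 1) (l 2)" "R (l 2) (l 3)" "R (l 3) (l 4)"
    using adj by (auto simp: numeral_eq_Suc)
  note na' = na(1) na(2) contrapos_nn[OF na(1) sym] contrapos_nn[OF na(2) sym]
  have d: "A1 \<noteq> B1" "A1 \<noteq> A2" "A1 \<noteq> B2" "B1 \<noteq> A2" "B1 \<noteq> B2" "A2 \<noteq> B2"
    using card by (auto simp: card_insert_if split: if_splits)
  have pos: "X = l 1 \<and> Y = l 3 \<or> X = l 3 \<and> Y = l 1 \<or> X = l 2 \<and> Y = l 4 \<or> X = l 4 \<and> Y = l 2 \<or>
      X = l 1 \<and> Y = l 4 \<or> X = l 4 \<and> Y = l 1"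
    if X: "X \<in> {A1, B1, A2, B2}" and Y: "Y \<in> {A1, B1, A2, B2}" and na: "X \<noteq> Y" "\<not> R X Y" "\<not> R Y X" for X Y
  proof -
    have im: "l ` {1, 2, 3, 4} = {A1, B1, A2, B2}" using bij unfolding bij_betw_def set by blast
    have "X \<in> {l 1, l 2, l 3, l 4}" "Y \<in> {l 1, l 2, l 3, l 4}" using X Y unfolding im[symmetric] by auto
    then show ?thesis using na R unfolding insert_iff empty_iff simp_thms by (elim disjE) simp_all
  qed
  have "f (l 1) + f (l 3) = f A1 + f B2 \<and> f (l 2) + f (l 4) = f B1 + f A2 \<or>
        f (l 1) + f (l 3) = f B1 + f A2 \<and> f (l 2) + f (l 4) = f A1 + f B2"
  proof -
    note p1 = pos[of A1 B2, OF _ _ d(3) na'(1,3)] and p2 = pos[of B1 A2, OF _ _ d(4) na'(2,4)]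
    show ?thesis
      using p1 p2 d by (elim meta_impE disjE conjE) simp_all
  qed
  then show ?thesis by (elim disjE conjE) linarith+
qed

context wf_mesh
begin

text \<open>The value of \<open>theta\<close> depends on the labeling only up to sign, so its vanishing is a condition
  on the cells alone.\<close>

lemma theta_boundary_edge:
  assumes L: "singular_edge_labeling \<Omega> \<T> L"
    and T: "T \<in> \<T>" "F facet_of T" and bd: "F \<subseteq> frontier \<Omega>"
    and vF: "verts F = {v, a, b}" "v \<noteq> a" "v \<noteq> b" "a \<noteq> b"
  shows "theta \<Omega> L (convex hull {split F, v}) q = 0 \<longleftrightarrow>
    cell_value q (cell T F a) = cell_value q (cell T F b)"
proof -
  let ?e = "convex hull {split F, v}"
  have v: "v \<in> verts F" using vF by simp
  have "{split F, v} \<subseteq> F"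
    using split_mem_facet[OF T] v by (auto simp: verts_def extreme_point_of_def)
  moreover have "convex F" using T(2) facet_of_imp_face_of face_of_imp_convex by blast
  ultimately have "?e \<subseteq> F" by (rule hull_minimal)
  then have fr: "?e \<subseteq> frontier \<Omega>" using bd by blast
  have "?e \<in> singular_edges (WF \<Omega> \<T>)" unfolding singular_edges_WF using T v by blast
  then have "bij_betw (L ?e) {1..2} {S \<in> WF \<Omega> \<T>. ?e edge_of S}"
    using L fr by (auto simp: singular_edge_labeling_def Let_def)
  moreover have "{S \<in> WF \<Omega> \<T>. ?e edge_of S} = {cell T F a, cell T F b}"
  proof -
    have "T' \<in> \<T> \<and> F facet_of T' \<and> u \<in> verts F - {v} \<longleftrightarrow> T' = T \<and> u \<in> {a, b}" for T' u
      using boundary_face_unique[OF bd T, of T'] T vF(2,3) unfolding vF(1) by blast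
    then show ?thesis unfolding cells_at_split_vert[OF T v] by auto
  qed
  ultimately have bij: "bij_betw (L ?e) {1..2} {cell T F a, cell T F b}" by simp
  have f: "flag T F a" "flag T F b" using T vF by (simp_all add: flag_def)
  have ne: "cell T F a \<noteq> cell T F b" using cell_inject[OF f] vF by blast
  have "{1..2::nat} = {1, 2}" by auto
  then have "L ?e ` {1, 2} = {cell T F a, cell T F b}" using bij by (simp add: bij_betw_def)
  then have "L ?e 1 = cell T F a \<and> L ?e 2 = cell T F b \<or> L ?e 1 = cell T F b \<and> L ?e 2 = cell T F a"
    using ne by (auto simp: doubleton_eq_iff)
  then show ?thesis using fr by (auto simp: theta_def)
qed

lemma theta_interior_edge:
  assumes L: "singular_edge_labeling \<Omega> \<T> L"
    and T: "T1 \<in> \<T>" "T2 \<in> \<T>" "T1 \<noteq> T2" and F: "F facet_of T1" "F facet_of T2"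
    and vF: "verts F = {v, a, b}" "v \<noteq> a" "v \<noteq> b" "a \<noteq> b"
  shows "theta \<Omega> L (convex hull {split F, v}) q = 0 \<longleftrightarrow>
    cell_value q (cell T1 F a) - cell_value q (cell T2 F a) =
    cell_value q (cell T1 F b) - cell_value q (cell T2 F b)"
proof -
  let ?e = "convex hull {split F, v}"
  let ?C = "{cell T1 F a, cell T1 F b, cell T2 F a, cell T2 F b}"
  have v: "v \<in> verts F" using vF by simp
  have "split F \<in> \<Omega>" using shared_face(1)[OF T F] split_rel_interior[OF T(1) F(1)] by blast
  then have "split F \<notin> frontier \<Omega>" using open_domain by (simp add: frontier_def interior_open)
  moreover have "split F \<in> ?e" by (simp add: hull_inc)
  ultimately have fr: "\<not> ?e \<subseteq> frontier \<Omega>" by blast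
  have sing: "?e \<in> singular_edges (WF \<Omega> \<T>)" unfolding singular_edges_WF using T F v by blast
  have lab: "bij_betw (L ?e) {1..4} {S \<in> WF \<Omega> \<T>. ?e edge_of S}"
      "\<forall>j\<in>{1..<4}. share_face (L ?e j) (L ?e (j + 1))"
    using bspec[OF L[unfolded singular_edge_labeling_def] sing] fr unfolding Let_def if_not_P[OF fr] by blast+
  have "{S \<in> WF \<Omega> \<T>. ?e edge_of S} = {cell T' F u |T' u. T' \<in> {T1, T2} \<and> u \<in> {a, b}}"
  proof -
    have "T' \<in> \<T> \<and> F facet_of T' \<and> u \<in> verts F - {v} \<longleftrightarrow> T' \<in> {T1, T2} \<and> u \<in> {a, b}" for T' u
      using shared_face(3)[OF T F, of T'] T F vF(2,3) unfolding vF(1) by blast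
    then show ?thesis unfolding cells_at_split_vert[OF T(1) F(1) v] by simp
  qed
  also have "\<dots> = ?C" by auto
  finally have bij: "bij_betw (L ?e) {1..4} ?C" using lab(1) by simp
  have f: "flag T1 F a" "flag T1 F b" "flag T2 F a" "flag T2 F b"
    using T F vF by (simp_all add: flag_def)
  have ne: "cell T1 F a \<noteq> cell T1 F b" "cell T1 F a \<noteq> cell T2 F a" "cell T1 F a \<noteq> cell T2 F b"
     "cell T1 F b \<noteq> cell T2 F a" "cell T1 F b \<noteq> cell T2 F b" "cell T2 F a \<noteq> cell T2 F b"
    using cell_inject[OF f(1) f(2)] cell_inject[OF f(1) f(3)] cell_inject[OF f(1) f(4)]
      cell_inject[OF f(2) f(3)] cell_inject[OF f(2) f(4)] cell_inject[OF f(3) f(4)] T(3) vF(4) by blast+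
  then have "card ?C = 4" by simp
  moreover have "\<not> share_face (cell T1 F a) (cell T2 F b)" "\<not> share_face (cell T1 F b) (cell T2 F a)"
    using share_face_across[OF f(1) f(4) T(3)] share_face_across[OF f(2) f(3) T(3)] vF(4) by auto
  ultimately have "cell_value q (L ?e 1) - cell_value q (L ?e 2) + cell_value q (L ?e 3) - cell_value q (L ?e 4) = 0
    \<longleftrightarrow> cell_value q (cell T1 F a) - cell_value q (cell T2 F a) =
      cell_value q (cell T1 F b) - cell_value q (cell T2 F b)"
    using alternating_sum_cycle[OF bij _ lab(2), of "cell_value q"] share_face_sym by blast
  then show ?thesis using fr by (simp add: theta_def)
qed

text \<open>The three conditions at a face combine: two vertices \<open>a\<close>, \<open>b\<close> of the face are compared by
  the singular edge at the third one. On a boundary face all three values agree; across an interior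
  face the three jumps agree.\<close>

lemma Y_hat_iff:
  assumes L: "singular_edge_labeling \<Omega> \<T> L"
  shows "q \<in> Y_hat \<Omega> \<T> L \<longleftrightarrow> q \<in> P0 (WF \<Omega> \<T>) \<and>
    (\<forall>T F. T \<in> \<T> \<and> F facet_of T \<and> F \<subseteq> frontier \<Omega> \<longrightarrow>
      (\<forall>a\<in>verts F. \<forall>b\<in>verts F. cell_value q (cell T F a) = cell_value q (cell T F b))) \<and>
    (\<forall>T1 T2 F. T1 \<in> \<T> \<and> T2 \<in> \<T> \<and> T1 \<noteq> T2 \<and> F facet_of T1 \<and> F facet_of T2 \<longrightarrow>
      (\<forall>a\<in>verts F. \<forall>b\<in>verts F.
        cell_value q (cell T1 F a) - cell_value q (cell T2 F a) =
        cell_value q (cell T1 F b) - cell_value q (cell T2 F b)))"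
    (is "_ \<longleftrightarrow> _ \<and> ?B \<and> ?I")
proof -
  have "(\<forall>e \<in> singular_edges (WF \<Omega> \<T>). theta \<Omega> L e q = 0) \<longleftrightarrow> ?B \<and> ?I"
  proof
    assume th: "\<forall>e \<in> singular_edges (WF \<Omega> \<T>). theta \<Omega> L e q = 0"
    have th': "theta \<Omega> L (convex hull {split F, v}) q = 0" if "T \<in> \<T>" "F facet_of T" "v \<in> verts F" for T F v
    proof (rule bspec[OF th])
      show "convex hull {split F, v} \<in> singular_edges (WF \<Omega> \<T>)"
        unfolding singular_edges_WF using that by blast
    qed
    have third: "\<exists>v. verts F = {v, a, b} \<and> v \<noteq> a \<and> v \<noteq> b"
      if T: "T \<in> \<T>" "F facet_of T" and ab: "a \<in> verts F" "b \<in> verts F" "a \<noteq> b" for T F a b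
    proof -
      obtain c d where cd: "verts F = {a, c, d}" "a \<noteq> c" "a \<noteq> d" "c \<noteq> d" by (rule verts_facet_cases[OF T ab(1)])
      then consider "b = c" | "b = d" using ab by auto
      then show ?thesis
      proof cases
        case 1
        then show ?thesis using cd by (intro exI[of _ d]) auto
      next
        case 2
        then show ?thesis using cd by (intro exI[of _ c]) auto
      qed
    qed
    have ?B
    proof clarify
      fix T F a b assume T: "T \<in> \<T>" "F facet_of T" "F \<subseteq> frontier \<Omega>" and ab: "a \<in> verts F" "b \<in> verts F"
      show "cell_value q (cell T F a) = cell_value q (cell T F b)"
      proof (cases "a = b")
        case False
        then obtain v where v: "verts F = {v, a, b}" "v \<noteq> a" "v \<noteq> b" using third T(1,2) ab by blast
        then show ?thesis using theta_boundary_edge[OF L T v False] th'[OF T(1,2), of v] by simp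
      qed simp
    qed
    moreover have ?I
    proof clarify
      fix T1 T2 F a b assume T: "T1 \<in> \<T>" "T2 \<in> \<T>" "T1 \<noteq> T2" and F: "F facet_of T1" "F facet_of T2"
        and ab: "a \<in> verts F" "b \<in> verts F"
      show "cell_value q (cell T1 F a) - cell_value q (cell T2 F a) =
        cell_value q (cell T1 F b) - cell_value q (cell T2 F b)"
      proof (cases "a = b")
        case False
        then obtain v where v: "verts F = {v, a, b}" "v \<noteq> a" "v \<noteq> b" using third T(1) F(1) ab by blast
        then show ?thesis using theta_interior_edge[OF L T F v False] th'[OF T(1) F(1), of v] by simp
      qed simp
    qed
    ultimately show "?B \<and> ?I" by blast
  next
    assume BI: "?B \<and> ?I"
    show "\<forall>e \<in> singular_edges (WF \<Omega> \<T>). theta \<Omega> L e q = 0"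
    proof
      fix e assume "e \<in> singular_edges (WF \<Omega> \<T>)"
      then have "e \<in> {convex hull {split F, v} |T F v. T \<in> \<T> \<and> F facet_of T \<and> v \<in> verts F}"
        unfolding singular_edges_WF .
      then obtain T F v where e: "e = convex hull {split F, v}" and T: "T \<in> \<T>" "F facet_of T" "v \<in> verts F"
        by blast
      obtain a b where vF: "verts F = {v, a, b}" "v \<noteq> a" "v \<noteq> b" "a \<noteq> b" by (rule verts_facet_cases[OF T])
      then have ab: "a \<in> verts F" "b \<in> verts F" by auto
      show "theta \<Omega> L e q = 0"
      proof (cases "F \<subseteq> frontier \<Omega>")
        case True
        show ?thesis
          unfolding e theta_boundary_edge[OF L T(1,2) True vF]
          by (intro conjunct1[OF BI, rule_format]) (use True T(1,2) ab in simp_all)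
      next
        case False
        then obtain T' where T': "T' \<in> \<T>" "T' \<noteq> T" "F facet_of T'"
          using interior_face_shared T by blast
        show ?thesis
          unfolding e theta_interior_edge[OF L T(1) T'(1) T'(2)[symmetric] T(2) T'(3) vF]
          by (rule conjunct2[OF BI, rule_format]) (use T(1,2) T' ab in simp_all)
      qed
    qed
  qed
  then show ?thesis by (simp add: Y_hat_def)
qed

end

section \<open>Labelings of the cells at the split points\<close>

context wf_mesh
begin

lemma cells_at_split:
  assumes T: "T \<in> \<T>" "F facet_of T"
  shows "{S \<in> WF \<Omega> \<T>. split F extreme_point_of S} = {cell T' F u |T' u. flag T' F u}"
proof (intro equalityI subsetI)
  fix S assume "S \<in> {S \<in> WF \<Omega> \<T>. split F extreme_point_of S}"
  then obtain T' F' u where f: "flag T' F' u" "S = cell T' F' u" "split F \<in> verts S"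
    by (auto simp: WF_eq verts_def)
  then have "split F \<in> cell_verts T' F' u" using verts_cell by blast
  then have "F = F'" using split_mem_cell_verts[OF f(1) T] by simp
  then show "S \<in> {cell T' F u |T' u. flag T' F u}" using f by blast
next
  fix S assume "S \<in> {cell T' F u |T' u. flag T' F u}"
  then obtain T' u where f: "flag T' F u" "S = cell T' F u" by blast
  have "split F \<in> verts S" using verts_cell[OF f(1)] f(2) by (simp add: cell_verts_def)
  then show "S \<in> {S \<in> WF \<Omega> \<T>. split F extreme_point_of S}"
    using f cell_in_WF by (simp add: verts_def)
qed

lemma cell_subset_imp_eq:
  assumes f: "flag T F u" and "S \<in> \<T>" "cell T F u \<subseteq> S"
  shows "T = S"
proof -
  have T: "T \<in> \<T>" using f by (simp add: flag_def)
  have "incenter T \<in> cell T F u" by (simp add: cell_def cell_verts_def hull_inc)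
  then show ?thesis
    using mesh_eqI[OF T assms(2)] incenter_interior[OF simplex_mesh[OF T]] assms(3) by blast
qed

lemma boundary_split_pointE:
  assumes "z \<in> boundary_split_points \<Omega> \<T>"
  obtains T F where "z = split F" "T \<in> \<T>" "F facet_of T" "F \<subseteq> frontier \<Omega>"
  using assms by (auto simp: boundary_split_points_def mesh_faces_def)

lemma interior_split_pointE:
  assumes "z \<in> interior_split_points \<Omega> \<T>"
  obtains T F where "z = split F" "T \<in> \<T>" "F facet_of T" "\<not> F \<subseteq> frontier \<Omega>"
  using assms by (auto simp: interior_split_points_def mesh_faces_def)

lemma split_points_disjoint:
  "z \<in> interior_split_points \<Omega> \<T> \<Longrightarrow> z \<notin> boundary_split_points \<Omega> \<T>"
  by (metis boundary_split_pointE interior_split_pointE split_inj)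

lemma split_point_cases:
  assumes "T \<in> \<T>" "F facet_of T"
  shows "if F \<subseteq> frontier \<Omega> then split F \<in> boundary_split_points \<Omega> \<T>
         else split F \<in> interior_split_points \<Omega> \<T>"
  using assms by (auto simp: boundary_split_points_def interior_split_points_def mesh_faces_def)

lemma finite_split_points:
  "finite (interior_split_points \<Omega> \<T>)" "finite (boundary_split_points \<Omega> \<T>)"
proof -
  have "mesh_faces \<T> = (\<Union>T\<in>\<T>. {F. F facet_of T})" by (auto simp: mesh_faces_def)
  moreover have "finite {F. F facet_of T}" if "T \<in> \<T>" for T
    using that simplex_mesh simplex_imp_polytope finite_polytope_facets by blast
  ultimately have "finite (mesh_faces \<T>)" using finite_mesh by simp
  then show "finite (interior_split_points \<Omega> \<T>)" "finite (boundary_split_points \<Omega> \<T>)"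
    by (simp_all add: interior_split_points_def boundary_split_points_def)
qed

end

text \<open>A mesh with an admissible labeling of the cells around each split point.\<close>

locale labeled_wf_mesh = wf_mesh +
  fixes K :: "point \<Rightarrow> nat \<Rightarrow> point set"
  assumes labeling: "split_point_labeling \<Omega> \<T> K"
begin

abbreviation "Zi \<equiv> interior_split_points \<Omega> \<T>"
abbreviation "Zb \<equiv> boundary_split_points \<Omega> \<T>"

lemma labeling_interior:
  assumes "z \<in> Zi"
  shows "bij_betw (K z) {1..6} {S \<in> WF \<Omega> \<T>. z extreme_point_of S}"
    and "\<exists>S1\<in>\<T>. \<exists>S2\<in>\<T>. (\<forall>j\<in>{1,2,3}. K z j \<subseteq> S1) \<and> (\<forall>j\<in>{4,5,6}. K z j \<subseteq> S2)"
    and "\<forall>j\<in>{1,2,3}. share_face (K z j) (K z (j + 3))"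
  using labeling[unfolded split_point_labeling_def, THEN conjunct1, rule_format, OF assms] by blast+

lemma labeling_boundary:
  assumes "z \<in> Zb"
  shows "bij_betw (K z) {1..3} {S \<in> WF \<Omega> \<T>. z extreme_point_of S}"
  using labeling[unfolded split_point_labeling_def, THEN conjunct2, rule_format, OF assms] .

text \<open>In terms of flags, an admissible labeling at an interior split point is an enumeration \<open>u\<close> of
  the vertices of the face, used on both sides.\<close>

lemma interior_labels:
  assumes z: "z \<in> Zi"
  shows "\<exists>F T1 T2 u. z = split F \<and> T1 \<in> \<T> \<and> T2 \<in> \<T> \<and> T1 \<noteq> T2 \<and> F facet_of T1 \<and> F facet_of T2 \<and>
    bij_betw u {1,2,3} (verts F) \<and> (\<forall>j\<in>{1,2,3}. K z j = cell T1 F (u j) \<and> K z (j + 3) = cell T2 F (u j))"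
proof -
  obtain T F where F: "z = split F" "T \<in> \<T>" "F facet_of T" by (rule interior_split_pointE[OF z])
  obtain S1 S2 where S: "S1 \<in> \<T>" "S2 \<in> \<T>" "\<forall>j\<in>{1,2,3}. K z j \<subseteq> S1" "\<forall>j\<in>{4,5,6}. K z j \<subseteq> S2"
    using labeling_interior(2)[OF z] by blast
  have bij: "bij_betw (K z) {1..6} {cell T' F u |T' u. flag T' F u}"
    using labeling_interior(1)[OF z] unfolding F(1) cells_at_split[OF F(2,3)] .
  note sf = labeling_interior(3)[OF z]
  have ex: "\<exists>u. flag S F u \<and> K z j = cell S F u" if j: "j \<in> {1..6}" "S \<in> \<T>" "K z j \<subseteq> S" for j S
  proof -
    obtain T' u where f: "flag T' F u" "K z j = cell T' F u" using bij_betw_apply[OF bij j(1)] by blast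
    then have "T' = S" using cell_subset_imp_eq[OF f(1) j(2)] j(3) by simp
    then show ?thesis using f by blast
  qed
  have "\<forall>j\<in>{1,2,3}. \<exists>u. flag S1 F u \<and> K z j = cell S1 F u" using ex[of _ S1] S by simp
  then obtain u where u: "\<forall>j\<in>{1,2,3}. flag S1 F (u j) \<and> K z j = cell S1 F (u j)" by metis
  have "\<forall>j\<in>{1,2,3}. \<exists>u. flag S2 F u \<and> K z (j + 3) = cell S2 F u"
    using ex[of _ S2] S by (simp add: numeral_eq_Suc)
  then obtain u' where u': "\<forall>j\<in>{1,2,3}. flag S2 F (u' j) \<and> K z (j + 3) = cell S2 F (u' j)" by metis
  have FS: "F facet_of S1" "F facet_of S2" using u u' by (auto simp: flag_def)
  note V = card_verts_facet(1)[OF S(1) FS(1)]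
  have finV: "finite (verts F)" using V by (simp add: card_ge_0_finite)
  \<comment> \<open>the six cells at \<open>z\<close> cannot all lie in one tetrahedron, which has only three of them\<close>
  have ne: "S1 \<noteq> S2"
  proof
    assume eq: "S1 = S2"
    have "K z j \<in> cell S1 F ` verts F" if j: "j \<in> {1..6}" for j
    proof -
      have "j \<in> {1,2,3} \<or> (\<exists>i\<in>{1,2,3}. j = i + 3)" using j by auto
      then show ?thesis using u u' eq by (auto simp: flag_def)
    qed
    then have "K z ` {1..6} \<subseteq> cell S1 F ` verts F" by blast
    then have "card (K z ` {1..6}) \<le> card (verts F)"
      using finV card_image_le[OF finV] by (meson card_mono finite_imageI le_trans)
    moreover have "card (K z ` {1..6}) = 6" using card_image[OF bij_betw_imp_inj_on[OF bij]] by simp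
    ultimately show False using V by simp
  qed
  have uu: "u' j = u j" if j: "j \<in> {1,2,3}" for j
  proof -
    have fs: "flag S1 F (u j)" "flag S2 F (u' j)" "share_face (cell S1 F (u j)) (cell S2 F (u' j))"
      using u u' sf j by auto
    show ?thesis using share_face_across[OF fs(1,2) ne fs(3)] by simp
  qed
  have "inj_on u {1,2,3}"
  proof (rule inj_onI)
    fix i j assume "i \<in> {1,2,3::nat}" "j \<in> {1,2,3::nat}" "u i = u j"
    then have "K z i = K z j" "i \<in> {1..6}" "j \<in> {1..6}" using u by auto
    then show "i = j" by (rule inj_onD[OF bij_betw_imp_inj_on[OF bij]])
  qed
  moreover have "u ` {1,2,3} \<subseteq> verts F" using u by (auto simp: flag_def)
  ultimately have "bij_betw u {1,2,3} (verts F)"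
    using V finV by (simp add: bij_betw_def card_image card_subset_eq)
  then show ?thesis using F(1) S(1,2) ne FS u u' uu
    by (intro exI[of _ F] exI[of _ S1] exI[of _ S2] exI[of _ u]) auto
qed

lemma boundary_labels:
  assumes z: "z \<in> Zb"
  shows "\<exists>F T u. z = split F \<and> T \<in> \<T> \<and> F facet_of T \<and> F \<subseteq> frontier \<Omega> \<and>
    bij_betw u {1,2,3} (verts F) \<and> (\<forall>j\<in>{1,2,3}. K z j = cell T F (u j))"
proof -
  obtain T F where F: "z = split F" "T \<in> \<T>" "F facet_of T" "F \<subseteq> frontier \<Omega>"
    by (rule boundary_split_pointE[OF z])
  have set: "{1..3::nat} = {1,2,3}" by auto
  have "bij_betw (K z) {1..3} {cell T' F u |T' u. flag T' F u}"
    using labeling_boundary[OF z] unfolding F(1) cells_at_split[OF F(2,3)] .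
  then have bij: "bij_betw (K z) {1,2,3} {cell T' F u |T' u. flag T' F u}" unfolding set .
  have "\<exists>u. flag T F u \<and> K z j = cell T F u" if j: "j \<in> {1,2,3}" for j
  proof -
    obtain T' u where f: "flag T' F u" "K z j = cell T' F u" using bij_betw_apply[OF bij j] by blast
    then have "T' = T" using boundary_face_unique[OF F(4,2,3)] by (simp add: flag_def)
    then show ?thesis using f by blast
  qed
  then obtain u where u: "\<forall>j\<in>{1,2,3}. flag T F (u j) \<and> K z j = cell T F (u j)" by metis
  note V = card_verts_facet(1)[OF F(2,3)]
  have finV: "finite (verts F)" using V by (simp add: card_ge_0_finite)
  have "inj_on u {1,2,3}"
  proof (rule inj_onI)
    fix i j assume ij: "i \<in> {1,2,3::nat}" "j \<in> {1,2,3::nat}" "u i = u j"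
    then have "K z i = K z j" using u by metis
    then show "i = j" using ij(1,2) by (rule inj_onD[OF bij_betw_imp_inj_on[OF bij]])
  qed
  moreover have "u ` {1,2,3} \<subseteq> verts F" using u by (auto simp: flag_def)
  ultimately have "bij_betw u {1,2,3} (verts F)"
    using V finV by (simp add: bij_betw_def card_image card_subset_eq)
  then show ?thesis using F u by blast
qed

text \<open>The valid labels \<open>(z, j)\<close>; they enumerate the cells without repetition.\<close>

definition labels :: "(point \<times> nat) set" where
  "labels = Zi \<times> {1..6} \<union> Zb \<times> {1..3}"

lemma label_cell:
  assumes "(z, j) \<in> labels"
  obtains T F u where "flag T F u" "z = split F" "K z j = cell T F u"
proof -
  have "z \<in> Zi \<or> z \<in> Zb" using assms by (auto simp: labels_def)
  then obtain T F where F: "z = split F" "T \<in> \<T>" "F facet_of T"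
    using interior_split_pointE boundary_split_pointE by metis
  have "K z j \<in> {S \<in> WF \<Omega> \<T>. z extreme_point_of S}"
    using assms bij_betw_apply[OF labeling_interior(1)] bij_betw_apply[OF labeling_boundary]
    unfolding labels_def by blast
  then have "K z j \<in> {cell T' F u |T' u. flag T' F u}"
    using cells_at_split[OF F(2,3)] F(1) by simp
  then show ?thesis using that F(1) by blast
qed

lemma label_inject:
  assumes l: "(z, j) \<in> labels" "(z', j') \<in> labels"
    and x: "x \<in> interior (K z j)" "x \<in> interior (K z' j')"
  shows "z = z' \<and> j = j'"
proof -
  obtain T F u where f: "flag T F u" "z = split F" "K z j = cell T F u" by (rule label_cell[OF l(1)])
  obtain T' F' u' where f': "flag T' F' u'" "z' = split F'" "K z' j' = cell T' F' u'" by (rule label_cell[OF l(2)])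
  have "T = T' \<and> F = F' \<and> u = u'" using cell_eqI[OF f(1) f'(1)] x f(3) f'(3) by simp
  then have z: "z = z'" and K: "K z j = K z j'" using f f' by auto
  have "inj_on (K z) {1..6} \<and> j \<in> {1..6} \<and> j' \<in> {1..6} \<or> inj_on (K z) {1..3} \<and> j \<in> {1..3} \<and> j' \<in> {1..3}"
    using l z split_points_disjoint[of z] bij_betw_imp_inj_on[OF labeling_interior(1)]
      bij_betw_imp_inj_on[OF labeling_boundary] unfolding labels_def by blast
  then have "j = j'" using K by (auto dest: inj_onD)
  then show ?thesis using z by simp
qed

lemma label_exists:
  assumes "S \<in> WF \<Omega> \<T>"
  obtains z j where "(z, j) \<in> labels" "S = K z j"
proof -
  obtain T F u where f: "flag T F u" "S = cell T F u" using assms by (auto simp: WF_eq)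
  then have T: "T \<in> \<T>" "F facet_of T" by (auto simp: flag_def)
  have S: "S \<in> {S \<in> WF \<Omega> \<T>. split F extreme_point_of S}"
    unfolding cells_at_split[OF T] using f by blast
  show ?thesis
  proof (cases "F \<subseteq> frontier \<Omega>")
    case True
    then have z: "split F \<in> Zb" using split_point_cases[OF T] by simp
    then have "S \<in> K (split F) ` {1..3}" using S bij_betw_imp_surj_on[OF labeling_boundary[OF z]] by simp
    then obtain j where "j \<in> {1..3}" "S = K (split F) j" by blast
    then show ?thesis using that[of "split F" j] z by (simp add: labels_def)
  next
    case False
    then have z: "split F \<in> Zi" using split_point_cases[OF T] by simp
    then have "S \<in> K (split F) ` {1..6}" using S bij_betw_imp_surj_on[OF labeling_interior(1)[OF z]] by simp
    then obtain j where "j \<in> {1..6}" "S = K (split F) j" by blast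
    then show ?thesis using that[of "split F" j] z by (simp add: labels_def)
  qed
qed

lemma label_in_WF: "(z, j) \<in> labels \<Longrightarrow> K z j \<in> WF \<Omega> \<T>"
  by (metis label_cell cell_in_WF)

text \<open>A sample point in each open cell; evaluation there is the value of a piecewise constant
  function on the cell.\<close>

definition pt :: "point \<Rightarrow> nat \<Rightarrow> point" where
  "pt z j = (SOME x. x \<in> interior (K z j))"

lemma pt_interior: "(z, j) \<in> labels \<Longrightarrow> pt z j \<in> interior (K z j)"
  unfolding pt_def by (metis label_cell interior_cell_nonempty some_in_eq)

lemma P0_const:
  assumes "q \<in> P0 (WF \<Omega> \<T>)" "(z, j) \<in> labels" "x \<in> interior (K z j)"
  shows "q x = q (pt z j)"
  using assms label_in_WF[OF assms(2)] pt_interior[OF assms(2)] by (fastforce simp: P0_def)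

lemma cell_value_pt:
  assumes "q \<in> P0 (WF \<Omega> \<T>)" "(z, j) \<in> labels"
  shows "cell_value q (K z j) = q (pt z j)"
  unfolding cell_value_def
proof (rule the_equality)
  show "\<forall>x\<in>interior (K z j). q x = q (pt z j)" using P0_const[OF assms] by blast
  show "c = q (pt z j)" if "\<forall>x\<in>interior (K z j). q x = c" for c
    using that pt_interior[OF assms(2)] by simp
qed

lemma labels_Zi: "z \<in> Zi \<Longrightarrow> j \<in> {1..6} \<Longrightarrow> (z, j) \<in> labels"
  and labels_Zb: "z \<in> Zb \<Longrightarrow> j \<in> {1..3} \<Longrightarrow> (z, j) \<in> labels"
  by (auto simp: labels_def)

lemma Y_hat_iff_labels:
  assumes L: "singular_edge_labeling \<Omega> \<T> L"
  shows "q \<in> Y_hat \<Omega> \<T> L \<longleftrightarrow> q \<in> P0 (WF \<Omega> \<T>) \<and>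
    (\<forall>z\<in>Zi. q (pt z 1) - q (pt z 4) = q (pt z 3) - q (pt z 6) \<and>
            q (pt z 2) - q (pt z 5) = q (pt z 3) - q (pt z 6)) \<and>
    (\<forall>z\<in>Zb. q (pt z 1) = q (pt z 3) \<and> q (pt z 2) = q (pt z 3))"
    (is "_ \<longleftrightarrow> _ \<and> ?I \<and> ?B")
proof (cases "q \<in> P0 (WF \<Omega> \<T>)")
  case False
  then show ?thesis by (simp add: Y_hat_iff[OF L])
next
  case q: True
  note cv = cell_value_pt[OF q]
  show ?thesis
  proof
    assume "q \<in> Y_hat \<Omega> \<T> L"
    note Y = this[unfolded Y_hat_iff[OF L]]
    note YB = Y[THEN conjunct2, THEN conjunct1, rule_format]
    note YI = Y[THEN conjunct2, THEN conjunct2, rule_format]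
    have ?I
    proof
      fix z assume z: "z \<in> Zi"
      obtain F T1 T2 u where F: "T1 \<in> \<T>" "T2 \<in> \<T>" "T1 \<noteq> T2" "F facet_of T1" "F facet_of T2"
        "bij_betw u {1,2,3} (verts F)" and Kz: "\<forall>j\<in>{1,2,3}. K z j = cell T1 F (u j) \<and> K z (j + 3) = cell T2 F (u j)"
        using interior_labels[OF z] by blast
      have "cell_value q (K z j) - cell_value q (K z (j + 3)) = cell_value q (K z 3) - cell_value q (K z (3 + 3))"
        if "j \<in> {1,2,3}" for j
      proof -
        have "u j \<in> verts F" "u 3 \<in> verts F" using bij_betw_apply[OF F(6)] that by auto
        moreover have "K z j = cell T1 F (u j)" "K z (j + 3) = cell T2 F (u j)"
          "K z 3 = cell T1 F (u 3)" "K z (3 + 3) = cell T2 F (u 3)"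
          using Kz that by blast+
        ultimately show ?thesis using YI[of T1 T2 F "u j" "u 3"] F(1-5) by simp
      qed
      from this[of 1] this[of 2]
      show "q (pt z 1) - q (pt z 4) = q (pt z 3) - q (pt z 6) \<and> q (pt z 2) - q (pt z 5) = q (pt z 3) - q (pt z 6)"
        using cv labels_Zi[OF z] by simp
    qed
    moreover have ?B
    proof
      fix z assume z: "z \<in> Zb"
      obtain F T u where F: "T \<in> \<T>" "F facet_of T" "F \<subseteq> frontier \<Omega>"
        "bij_betw u {1,2,3} (verts F)" and Kz: "\<forall>j\<in>{1,2,3}. K z j = cell T F (u j)"
        using boundary_labels[OF z] by blast
      have "cell_value q (K z j) = cell_value q (K z 3)" if "j \<in> {1,2,3}" for j
      proof -
        have "u j \<in> verts F" "u 3 \<in> verts F" using bij_betw_apply[OF F(4)] that by auto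
        moreover have "K z j = cell T F (u j)" "K z 3 = cell T F (u 3)" using Kz that by blast+
        ultimately show ?thesis using YB[of T F "u j" "u 3"] F(1-3) by simp
      qed
      from this[of 1] this[of 2]
      show "q (pt z 1) = q (pt z 3) \<and> q (pt z 2) = q (pt z 3)" using cv labels_Zb[OF z] by simp
    qed
    ultimately show "q \<in> P0 (WF \<Omega> \<T>) \<and> ?I \<and> ?B" using q by blast
  next
    assume R: "q \<in> P0 (WF \<Omega> \<T>) \<and> ?I \<and> ?B"
    have cvI: "cell_value q (K z j) - cell_value q (K z (j + 3)) = q (pt z 3) - q (pt z 6)"
      if "z \<in> Zi" "j \<in> {1,2,3}" for z j
      using that R cv labels_Zi[OF that(1)] by auto
    have cvB: "cell_value q (K z j) = q (pt z 3)" if "z \<in> Zb" "j \<in> {1,2,3}" for z j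
      using that R cv labels_Zb[OF that(1)] by auto
    show "q \<in> Y_hat \<Omega> \<T> L"
      unfolding Y_hat_iff[OF L]
    proof (intro conjI q allI impI ballI; elim conjE)
      fix T F a b assume T: "T \<in> \<T>" "F facet_of T" and bd: "F \<subseteq> frontier \<Omega>" and ab: "a \<in> verts F" "b \<in> verts F"
      have z: "split F \<in> Zb" using split_point_cases[OF T] bd by simp
      obtain F' T' u where F': "split F = split F'" "T' \<in> \<T>" "F' facet_of T'" "F' \<subseteq> frontier \<Omega>"
        "bij_betw u {1,2,3} (verts F')" and Kz: "\<forall>j\<in>{1,2,3}. K (split F) j = cell T' F' (u j)"
        using boundary_labels[OF z] by blast
      have FF: "F' = F" using split_inj[OF T(1) F'(2) T(2) F'(3) F'(1)] by simp
      have TT: "T' = T" using boundary_face_unique[OF bd T F'(2)] F'(3) FF by simp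
      have "cell_value q (cell T F c) = q (pt (split F) 3)" if c: "c \<in> verts F" for c
      proof -
        obtain j where j: "j \<in> {1,2,3}" "c = u j" using F'(5) c FF unfolding bij_betw_def by blast
        have "K (split F) j = cell T F c" using bspec[OF Kz j(1)] FF TT j(2) by simp
        then show ?thesis using cvB[OF z j(1)] by simp
      qed
      then show "cell_value q (cell T F a) = cell_value q (cell T F b)" using ab by simp
    next
      fix T1 T2 F a b assume T: "T1 \<in> \<T>" "T2 \<in> \<T>" "T1 \<noteq> T2" and F: "F facet_of T1" "F facet_of T2"
        and ab: "a \<in> verts F" "b \<in> verts F"
      have z: "split F \<in> Zi" using split_point_cases[OF T(1) F(1)] shared_face_not_boundary[OF T F] by simp
      obtain F' S1 S2 u where F': "split F = split F'" "S1 \<in> \<T>" "S2 \<in> \<T>" "S1 \<noteq> S2" "F' facet_of S1" "F' facet_of S2"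
        "bij_betw u {1,2,3} (verts F')"
        and Kz: "\<forall>j\<in>{1,2,3}. K (split F) j = cell S1 F' (u j) \<and> K (split F) (j + 3) = cell S2 F' (u j)"
        using interior_labels[OF z] by blast
      have FF: "F' = F" using split_inj[OF T(1) F'(2) F(1) F'(5) F'(1)] by simp
      have SS: "S1 = T1 \<and> S2 = T2 \<or> S1 = T2 \<and> S2 = T1"
        using shared_face(3)[OF T F, of S1] shared_face(3)[OF T F, of S2] F' FF by auto
      have "cell_value q (cell S1 F c) - cell_value q (cell S2 F c) = q (pt (split F) 3) - q (pt (split F) 6)"
        if c: "c \<in> verts F" for c
      proof -
        obtain j where j: "j \<in> {1,2,3}" "c = u j" using F'(7) c FF unfolding bij_betw_def by blast
        have "K (split F) j = cell S1 F c" "K (split F) (j + 3) = cell S2 F c"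
          using bspec[OF Kz j(1)] FF j(2) by simp_all
        then show ?thesis using cvI[OF z j(1)] by simp
      qed
      from this[OF ab(1)] this[OF ab(2)] SS
      show "cell_value q (cell T1 F a) - cell_value q (cell T2 F a) =
            cell_value q (cell T1 F b) - cell_value q (cell T2 F b)" by auto
    qed
  qed
qed

end

section \<open>The basis\<close>

lemma sum_apply: "(\<Sum>i\<in>A. f i) x = (\<Sum>i\<in>A. f i x)" for f :: "'i \<Rightarrow> 'b \<Rightarrow> real"
  by (induction A rule: infinite_finite_induct) simp_all

text \<open>Functions that are dual to evaluation at some points are distinct and independent.\<close>

lemma dual_points_independent:
  fixes f :: "'i \<Rightarrow> 'b \<Rightarrow> real"
  assumes fin: "finite I" and dual: "\<And>i k. i \<in> I \<Longrightarrow> k \<in> I \<Longrightarrow> f i (p k) = (if i = k then 1 else 0)"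
  shows "inj_on f I" "independent (f ` I)"
proof -
  show inj: "inj_on f I"
  proof (rule inj_onI)
    fix i k assume "i \<in> I" "k \<in> I" "f i = f k"
    then show "i = k" using dual[of i k] dual[of k k] by (auto split: if_splits)
  qed
  show "independent (f ` I)"
  proof (rule independent_if_scalars_zero)
    fix g x assume g: "(\<Sum>x\<in>f ` I. g x *\<^sub>R x) = 0" and "x \<in> f ` I"
    then obtain k where k: "k \<in> I" "x = f k" by blast
    have "0 = (\<Sum>i\<in>I. g (f i) *\<^sub>R f i) (p k)"
      using g by (simp add: sum.reindex[OF inj])
    also have "\<dots> = (\<Sum>i\<in>I. g (f i) * f i (p k))"
      by (simp add: sum_apply scaleR_fun_def)
    also have "\<dots> = (\<Sum>i\<in>I. if i = k then g (f k) else 0)"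
      by (rule sum.cong) (auto simp: dual k(1))
    also have "\<dots> = g (f k)" using fin k(1) by simp
    finally show "g x = 0" using k(2) by simp
  qed (simp add: fin)
qed

text \<open>The value of \<open>psi K z j\<close> on the cell \<open>K z i\<close>; the last branch is \<open>j = 6\<close>, and only
  \<open>j\<close> between 3 and 6 occurs.\<close>

definition psi_coeff :: "nat \<Rightarrow> nat \<Rightarrow> real" where
  "psi_coeff j i =
     (if j = 3 then (if i \<in> {1, 2, 3} then 1 else 0)
      else if j = 4 then (if i \<in> {1, 4} then 1 else 0)
      else if j = 5 then (if i \<in> {2, 5} then 1 else 0)
      else (if i = 6 then 1 else if i \<in> {1, 2} then -1 else 0))"

context labeled_wf_mesh
begin

lemma psi_index_labels: "(z, j) \<in> psi_index \<Omega> \<T> \<Longrightarrow> (z, j) \<in> labels"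
  by (auto simp: psi_index_def labels_def)

lemma finite_psi_index: "finite (psi_index \<Omega> \<T>)"
  using finite_split_points by (simp add: psi_index_def)

lemma phi_value:
  assumes "(z, j) \<in> labels" "(z', i) \<in> labels" "x \<in> interior (K z' i)"
  shows "phi K z j x = (if z = z' \<and> j = i then 1 else 0)"
proof -
  have "x \<in> interior (K z j) \<longleftrightarrow> z = z' \<and> j = i"
    using label_inject[OF assms(1,2) _ assms(3)] assms(3) by blast
  then show ?thesis by (simp add: phi_def indicator_def)
qed

lemma psi_value:
  assumes I: "(z, j) \<in> psi_index \<Omega> \<T>" and l: "(z', i) \<in> labels" and x: "x \<in> interior (K z' i)"
  shows "psi K z j x = (if z = z' then psi_coeff j i else 0)"
proof -
  have phi: "phi K z m x = (if z = z' \<and> m = i then 1 else 0)" if "(z, m) \<in> labels" for m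
    using phi_value[OF that l x] .
  have low: "(z, 1) \<in> labels" "(z, 2) \<in> labels" "(z, 3) \<in> labels"
    using I by (auto simp: psi_index_def labels_def)
  consider "j = 3" | "z \<in> Zi" "j = 4" | "z \<in> Zi" "j = 5" | "z \<in> Zi" "j = 6"
    using I by (auto simp: psi_index_def)
  then show ?thesis
  proof cases
    case 1
    then show ?thesis using phi[OF low(1)] phi[OF low(2)] phi[OF low(3)]
      by (auto simp: psi_def psi_coeff_def)
  next
    case 2
    then have "(z, 4) \<in> labels" by (simp add: labels_def)
    then show ?thesis using 2 phi[OF low(1)] phi[of 4] by (auto simp: psi_def psi_coeff_def)
  next
    case 3
    then have "(z, 5) \<in> labels" by (simp add: labels_def)
    then show ?thesis using 3 phi[OF low(2)] phi[of 5] by (auto simp: psi_def psi_coeff_def)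
  next
    case 4
    then have "(z, 6) \<in> labels" by (simp add: labels_def)
    then show ?thesis using 4 phi[OF low(1)] phi[OF low(2)] phi[of 6]
      by (auto simp: psi_def psi_coeff_def)
  qed
qed

lemma psi_pt:
  assumes "(z, j) \<in> psi_index \<Omega> \<T>" "(z', i) \<in> labels"
  shows "psi K z j (pt z' i) = (if z = z' then psi_coeff j i else 0)"
  using psi_value assms pt_interior by blast

lemma in_cell_label:
  assumes "x \<in> (\<Union>S\<in>WF \<Omega> \<T>. interior S)"
  obtains z j where "(z, j) \<in> labels" "x \<in> interior (K z j)"
  using assms label_exists by (metis UN_E)

lemma psi_outside:
  assumes I: "(z, j) \<in> psi_index \<Omega> \<T>" and x: "x \<notin> (\<Union>S\<in>WF \<Omega> \<T>. interior S)"
  shows "psi K z j x = 0"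
proof -
  have phi: "phi K z m x = 0" if "(z, m) \<in> labels" for m
    using x label_in_WF[OF that] by (auto simp: phi_def)
  have low: "(z, 1) \<in> labels" "(z, 2) \<in> labels" "(z, 3) \<in> labels"
    using I by (auto simp: psi_index_def labels_def)
  have "(z, j) \<in> labels" using I by (rule psi_index_labels)
  then show ?thesis using phi low I by (auto simp: psi_def psi_index_def)
qed

lemma psi_P0:
  assumes I: "(z, j) \<in> psi_index \<Omega> \<T>"
  shows "psi K z j \<in> P0 (WF \<Omega> \<T>)"
  unfolding P0_def
proof (intro CollectI conjI ballI allI impI)
  fix S assume "S \<in> WF \<Omega> \<T>"
  then obtain z' i where l: "(z', i) \<in> labels" "S = K z' i" by (rule label_exists)
  show "\<exists>c. \<forall>x\<in>interior S. psi K z j x = c" using psi_value[OF I l(1)] l(2) by blast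
next
  show "psi K z j x = 0" if "x \<notin> (\<Union>S\<in>WF \<Omega> \<T>. interior S)" for x
    using psi_outside[OF I that] .
qed

lemma psi_Y_hat:
  assumes L: "singular_edge_labeling \<Omega> \<T> L" and I: "(z, j) \<in> psi_index \<Omega> \<T>"
  shows "psi K z j \<in> Y_hat \<Omega> \<T> L"
  unfolding Y_hat_iff_labels[OF L]
proof (intro conjI ballI psi_P0 I)
  have j: "j = 3 \<or> j = 4 \<or> j = 5 \<or> j = 6" using I by (auto simp: psi_index_def)
  fix z' assume z': "z' \<in> Zi"
  have p: "psi K z j (pt z' i) = (if z = z' then psi_coeff j i else 0)" if "i \<in> {1..6}" for i
    using psi_pt[OF I labels_Zi[OF z' that]] .
  show "psi K z j (pt z' 1) - psi K z j (pt z' 4) = psi K z j (pt z' 3) - psi K z j (pt z' 6)"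
    "psi K z j (pt z' 2) - psi K z j (pt z' 5) = psi K z j (pt z' 3) - psi K z j (pt z' 6)"
    using j by (auto simp: p psi_coeff_def)
next
  fix z' assume z': "z' \<in> Zb"
  have p: "psi K z j (pt z' i) = (if z = z' then psi_coeff j i else 0)" if "i \<in> {1..3}" for i
    using psi_pt[OF I labels_Zb[OF z' that]] .
  have "j = 3" if "z = z'" using that I z' split_points_disjoint by (auto simp: psi_index_def)
  then show "psi K z j (pt z' 1) = psi K z j (pt z' 3)" "psi K z j (pt z' 2) = psi K z j (pt z' 3)"
    by (auto simp: p psi_coeff_def)
qed

lemma subspace_Y_hat:
  assumes L: "singular_edge_labeling \<Omega> \<T> L"
  shows "subspace (Y_hat \<Omega> \<T> L)"
proof -
  have P0I: "q \<in> P0 (WF \<Omega> \<T>)"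
    if "\<And>z j x. (z, j) \<in> labels \<Longrightarrow> x \<in> interior (K z j) \<Longrightarrow> q x = q (pt z j)"
      and "\<And>x. x \<notin> (\<Union>S\<in>WF \<Omega> \<T>. interior S) \<Longrightarrow> q x = 0" for q
    unfolding P0_def using that by (blast elim: label_exists)
  have out: "q x = 0" if "q \<in> P0 (WF \<Omega> \<T>)" "x \<notin> (\<Union>S\<in>WF \<Omega> \<T>. interior S)" for q x
    using that unfolding P0_def by blast
  have 0: "0 \<in> P0 (WF \<Omega> \<T>)" by (rule P0I) simp_all
  have add: "q + r \<in> P0 (WF \<Omega> \<T>)" if qr: "q \<in> P0 (WF \<Omega> \<T>)" "r \<in> P0 (WF \<Omega> \<T>)" for q r
  proof (rule P0I)
    show "(q + r) x = (q + r) (pt z j)" if "(z, j) \<in> labels" "x \<in> interior (K z j)" for z j x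
      using P0_const[OF qr(1) that] P0_const[OF qr(2) that] by simp
    show "(q + r) x = 0" if "x \<notin> (\<Union>S\<in>WF \<Omega> \<T>. interior S)" for x
      using out[OF qr(1) that] out[OF qr(2) that] by simp
  qed
  have scale: "c *\<^sub>R q \<in> P0 (WF \<Omega> \<T>)" if q: "q \<in> P0 (WF \<Omega> \<T>)" for c q
  proof (rule P0I)
    show "(c *\<^sub>R q) x = (c *\<^sub>R q) (pt z j)" if "(z, j) \<in> labels" "x \<in> interior (K z j)" for z j x
      using P0_const[OF q that] by (simp add: scaleR_fun_def)
    show "(c *\<^sub>R q) x = 0" if "x \<notin> (\<Union>S\<in>WF \<Omega> \<T>. interior S)" for x
      using out[OF q that] by (simp add: scaleR_fun_def)
  qed
  show ?thesis
  proof (rule subspaceI)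
    show "0 \<in> Y_hat \<Omega> \<T> L" unfolding Y_hat_iff_labels[OF L] using 0 by simp
  next
    fix q r assume q: "q \<in> Y_hat \<Omega> \<T> L" and r: "r \<in> Y_hat \<Omega> \<T> L"
    note Yq = q[unfolded Y_hat_iff_labels[OF L]] and Yr = r[unfolded Y_hat_iff_labels[OF L]]
    show "q + r \<in> Y_hat \<Omega> \<T> L"
      unfolding Y_hat_iff_labels[OF L]
    proof (intro conjI ballI)
      show "q + r \<in> P0 (WF \<Omega> \<T>)" using add Yq Yr by blast
    next
      fix z assume "z \<in> Zi"
      with Yq Yr show "(q + r) (pt z 1) - (q + r) (pt z 4) = (q + r) (pt z 3) - (q + r) (pt z 6)"
        "(q + r) (pt z 2) - (q + r) (pt z 5) = (q + r) (pt z 3) - (q + r) (pt z 6)"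
        unfolding plus_fun_apply by (smt (verit))+
    next
      fix z assume "z \<in> Zb"
      with Yq Yr show "(q + r) (pt z 1) = (q + r) (pt z 3)" "(q + r) (pt z 2) = (q + r) (pt z 3)"
        by simp_all
    qed
  next
    fix c :: real and q assume q: "q \<in> Y_hat \<Omega> \<T> L"
    note Yq = q[unfolded Y_hat_iff_labels[OF L]]
    show "c *\<^sub>R q \<in> Y_hat \<Omega> \<T> L"
      unfolding Y_hat_iff_labels[OF L]
    proof (intro conjI ballI)
      show "c *\<^sub>R q \<in> P0 (WF \<Omega> \<T>)" using scale Yq by blast
    next
      fix z assume "z \<in> Zi"
      with Yq show "(c *\<^sub>R q) (pt z 1) - (c *\<^sub>R q) (pt z 4) = (c *\<^sub>R q) (pt z 3) - (c *\<^sub>R q) (pt z 6)"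
        "(c *\<^sub>R q) (pt z 2) - (c *\<^sub>R q) (pt z 5) = (c *\<^sub>R q) (pt z 3) - (c *\<^sub>R q) (pt z 6)"
        unfolding scaleR_fun_def real_scaleR_def right_diff_distrib[symmetric] by simp_all
    next
      fix z assume "z \<in> Zb"
      with Yq show "(c *\<^sub>R q) (pt z 1) = (c *\<^sub>R q) (pt z 3)" "(c *\<^sub>R q) (pt z 2) = (c *\<^sub>R q) (pt z 3)"
        by (simp_all add: scaleR_fun_def)
    qed
  qed
qed

text \<open>On the cells labeled 3 to 6 the expansion holds because the coefficients are the values
  there; the values on the cells labeled 1 and 2 are then forced by the conditions defining the
  space.\<close>

lemma Y_hat_expansion:
  assumes L: "singular_edge_labeling \<Omega> \<T> L" and q: "q \<in> Y_hat \<Omega> \<T> L"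
  shows "q = (\<Sum>(z, j)\<in>psi_index \<Omega> \<T>. q (pt z j) *\<^sub>R psi K z j)"
proof
  let ?I = "psi_index \<Omega> \<T>"
  note Y = q[unfolded Y_hat_iff_labels[OF L]]
  have qP: "q \<in> P0 (WF \<Omega> \<T>)" using Y by blast
  fix x
  have R: "(\<Sum>(z, j)\<in>?I. q (pt z j) *\<^sub>R psi K z j) x = (\<Sum>(z, j)\<in>?I. q (pt z j) * psi K z j x)"
    by (simp add: sum_apply scaleR_fun_def case_prod_beta)
  show "q x = (\<Sum>(z, j)\<in>?I. q (pt z j) *\<^sub>R psi K z j) x"
  proof (cases "x \<in> (\<Union>S\<in>WF \<Omega> \<T>. interior S)")
    case False
    then have "q x = 0" using qP by (simp add: P0_def)
    moreover have "(\<Sum>(z, j)\<in>?I. q (pt z j) * psi K z j x) = 0"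
      by (rule sum.neutral) (auto simp: psi_outside[OF _ False])
    ultimately show ?thesis using R by simp
  next
    case True
    then obtain z i where l: "(z, i) \<in> labels" and x: "x \<in> interior (K z i)" by (rule in_cell_label)
    have qx: "q x = q (pt z i)" by (rule P0_const[OF qP l x])
    define J where "J = (if z \<in> Zi then {3, 4, 5, 6} else {3::nat})"
    have zJ: "{z} \<times> J \<subseteq> ?I" "\<And>j. (z, j) \<in> ?I \<Longrightarrow> j \<in> J"
      using l split_points_disjoint[of z] by (auto simp: J_def psi_index_def labels_def)
    have "(\<Sum>(z', j)\<in>?I. q (pt z' j) * psi K z' j x) = (\<Sum>(z', j)\<in>{z} \<times> J. q (pt z' j) * psi K z' j x)"
      by (rule sum.mono_neutral_right) (use finite_psi_index zJ in \<open>auto simp: psi_value[OF _ l x] split: if_splits\<close>)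
    also have "\<dots> = (\<Sum>(z', j)\<in>{z} \<times> J. q (pt z j) * psi_coeff j i)"
      by (rule sum.cong) (use zJ(1) in \<open>auto simp: psi_value[OF _ l x]\<close>)
    also have "\<dots> = (\<Sum>j\<in>J. q (pt z j) * psi_coeff j i)"
      by (simp add: sum.cartesian_product[symmetric])
    also have "\<dots> = q (pt z i)"
    proof (cases "z \<in> Zi")
      case z: True
      have c: "q (pt z 1) = q (pt z 3) + q (pt z 4) - q (pt z 6)"
        "q (pt z 2) = q (pt z 3) + q (pt z 5) - q (pt z 6)"
        using Y z by (auto simp: algebra_simps)
      have "i \<in> {1..6}" using l split_points_disjoint[OF z] by (auto simp: labels_def)
      then have "i = 1 \<or> i = 2 \<or> i = 3 \<or> i = 4 \<or> i = 5 \<or> i = 6" by auto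
      then show ?thesis using z c by (auto simp: J_def psi_coeff_def)
    next
      case z: False
      then have zb: "z \<in> Zb" "i \<in> {1..3}" using l by (auto simp: labels_def)
      then have "i = 1 \<or> i = 2 \<or> i = 3" by auto
      moreover have "q (pt z 1) = q (pt z 3)" "q (pt z 2) = q (pt z 3)" using Y zb(1) by auto
      ultimately show ?thesis using z by (auto simp: J_def psi_coeff_def)
    qed
    finally show ?thesis using R qx by simp
  qed
qed

lemma psi_family_basis:
  assumes L: "singular_edge_labeling \<Omega> \<T> L"
  shows "family_basis (\<lambda>(z, j). psi K z j) (psi_index \<Omega> \<T>) (Y_hat \<Omega> \<T> L)"
proof -
  let ?I = "psi_index \<Omega> \<T>" and ?b = "\<lambda>(z, j). psi K z j"
  have "?b i ((\<lambda>(z, j). pt z j) k) = (if i = k then 1 else 0)" if "i \<in> ?I" "k \<in> ?I" for i k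
  proof -
    obtain z j z' j' where ik: "i = (z, j)" "k = (z', j')" by (cases i, cases k)
    have "j \<in> {3,4,5,6}" "j' \<in> {3,4,5,6}" using that ik by (auto simp: psi_index_def)
    then have "psi_coeff j j' = (if j = j' then 1 else 0)" by (auto simp: psi_coeff_def)
    then show ?thesis using psi_pt[of z j z' j'] psi_index_labels that ik by (auto split: if_splits)
  qed
  note dual = dual_points_independent[of ?I ?b "\<lambda>(z, j). pt z j", OF finite_psi_index this]
  have "span (?b ` ?I) = Y_hat \<Omega> \<T> L"
  proof
    have "?b ` ?I \<subseteq> Y_hat \<Omega> \<T> L" using psi_Y_hat[OF L] by auto
    then show "span (?b ` ?I) \<subseteq> Y_hat \<Omega> \<T> L" using span_minimal subspace_Y_hat[OF L] by blast
    show "Y_hat \<Omega> \<T> L \<subseteq> span (?b ` ?I)"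
    proof
      fix q assume "q \<in> Y_hat \<Omega> \<T> L"
      then have q: "q = (\<Sum>(z, j)\<in>?I. q (pt z j) *\<^sub>R psi K z j)" by (rule Y_hat_expansion[OF L])
      have "(\<Sum>(z, j)\<in>?I. q (pt z j) *\<^sub>R psi K z j) \<in> span (?b ` ?I)"
      proof (intro span_sum, clarify)
        fix z j assume "(z, j) \<in> ?I"
        then have "psi K z j \<in> ?b ` ?I" by force
        then show "q (pt z j) *\<^sub>R psi K z j \<in> span (?b ` ?I)" by (intro span_scale span_base)
      qed
      then show "q \<in> span (?b ` ?I)" using q by simp
    qed
  qed
  then show ?thesis unfolding family_basis_def using dual by blast
qed

end

theorem proposition6p2:
  fixes \<Omega> :: "(real^3) set" and \<T> :: "(real^3) set set" and \<gamma> :: real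
    and K :: "real^3 \<Rightarrow> nat \<Rightarrow> (real^3) set"
    and L :: "(real^3) set \<Rightarrow> nat \<Rightarrow> (real^3) set"
  assumes "polyhedral_domain \<Omega>" and "contractible \<Omega>"
    and "tet_mesh \<Omega> \<T>" and "shape_regular \<gamma> \<T>"
    and "split_point_labeling \<Omega> \<T> K"
    and "singular_edge_labeling \<Omega> \<T> L"
  shows "family_basis (\<lambda>(z, j). psi K z j) (psi_index \<Omega> \<T>) (Y_hat \<Omega> \<T> L)"
proof -
  interpret labeled_wf_mesh \<Omega> \<T> K
    using assms by unfold_locales
  show ?thesis by (rule psi_family_basis[OF assms(6)])
qed

end
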